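(* Let $B$ be a finite skew left brace with additive group $K$, let $\mathbb{F}$ be a field, let $\rho\colon K\to\operatorname{GL}(V)$ be a brace representation of $B$ over $\mathbb{F}$, and let $(G,K,H,E)$ be a trifactorised group associated with $B$. Put $T=(\ker\rho)H\cap(\ker\rho)E$, a normal subgroup of $G$ with $T\cap K=\ker\rho$, and regard $V$ as an $\mathbb{F}(KT)$-module via $(kt)\cdot v=\rho(k)(v)$ for $k\in K$, $t\in T$, $v\in V$ (this is well defined). Let $W=\mathbb{F}G\otimes_{\mathbb{F}(KT)}V$ and let $\bar{\bar\rho}\colon G\to\operatorname{GL}(W)$ be given by $\bar{\bar\rho}(g)(\omega\otimes v)=g\omega\otimes v$ for $g\in G$, $\omega\in\mathbb{F}G$, $v\in V$. Then $\bar{\bar\rho}$ is a trifactorised group representation of $(G,K,H,E)$. Moreover, $\bar{\bar\rho}$ is an induced trifactorised group representation of $\rho$ to $(G,K,H,E)$.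
   Context: A skew left brace is a triple $(B,+,\cdot)$ where $(B,+)$ and $(B,\cdot)$ are groups such that $a(b+c)=ab-a+ac$ for all $a,b,c\in B$. Write $K=(B,+)$, $C=(B,\cdot)$, $\delta\colon C\to K$ for the identity map, and $\lambda\colon C\to\operatorname{Aut}(K)$, $\lambda_c(b)=-c+cb$, for the lambda action (a group homomorphism). An ideal of $B$ is a subset $I$ that is a normal subgroup of $K$, a normal subgroup of $C$, and satisfies $\lambda_c(I)\subseteq I$ for all $c\in C$. A brace representation of $B$ over $\mathbb{F}$ is a group homomorphism $\rho\colon K\to\operatorname{GL}(V)$, $V$ an $\mathbb{F}$-vector space, such that $\ker\rho$ is an ideal of $B$. A trifactorised group is a $4$-tuple $(G,K,H,E)$ with $G$ a group, $K\trianglelefteq G$, $H,E\le G$, $G=KH=KE=HE$, $K\cap E=H\cap E=1$. It is associated with $B$ (with associated epimorphism $\eta\colon C\to E$) if $K$ is the additive group of $B$ (written multiplicatively inside $G$), $\eta\colon C\to E$ is a surjective group homomorphism with $\eta(c)k\eta(c)^{-1}=\lambda_c(k)$ for all $c\in C$, $k\in K$, and $H=\{\delta(c)\eta(c)\mid c\in C\}$. All groups here are finite. A trifactorised group representation of $(G,K,H,E)$ is a group homomorphism $\tau\colon G\to\operatorname{GL}(W)$ with $\ker\tau=(\ker\tau\cap K)H\cap(\ker\tau\cap K)E$. Given a brace representation $\rho\colon K\to\operatorname{GL}(V)$ of $B$ over $\mathbb{F}$, a group representation $\tau\colon G\to\operatorname{GL}(W)$ on an $\mathbb{F}$-vector space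 $W$ is an induced trifactorised group representation of $\rho$ to $(G,K,H,E)$ if: (IR1) $\ker\tau=(\ker\tau\cap K)H\cap(\ker\tau\cap K)E$; and (IR2) there is a $K$-invariant subspace $V_0$ of $W$ such that (a) there is an $\mathbb{F}K$-isomorphism $\alpha\colon V\to V_0$, i.e. a linear isomorphism with $\tau(k)\circ\alpha=\alpha\circ\rho(k)$ for all $k\in K$, and (b) $W=\bigoplus_{\bar e\in\bar E}\bar eV_0$, where $\bar E=E\ker\tau/\ker\tau$ and $\bar eV_0=\tau(e)(V_0)$ for $\bar e=e\ker\tau$, $e\in E$. *)

theory Defs
  imports "HOL-Algebra.Algebra"
begin

section \<open>Skew left braces and their representations\<close>

text \<open>A skew left brace is stored in a ring record: \<open>add_monoid B\<close> is the (not necessarily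
  commutative) additive group and \<open>B\<close> itself, as a monoid record, the multiplicative group.\<close>

definition skew_left_brace :: "'g ring \<Rightarrow> bool" where
  "skew_left_brace B \<longleftrightarrow> group (add_monoid B) \<and> group B \<and>
     (\<forall>a\<in>carrier B. \<forall>b\<in>carrier B. \<forall>c\<in>carrier B.
        a \<otimes>\<^bsub>B\<^esub> (b \<oplus>\<^bsub>B\<^esub> c) = ((a \<otimes>\<^bsub>B\<^esub> b) \<oplus>\<^bsub>B\<^esub> (\<ominus>\<^bsub>B\<^esub> a)) \<oplus>\<^bsub>B\<^esub> (a \<otimes>\<^bsub>B\<^esub> c))"

definition brace_lambda :: "'g ring \<Rightarrow> 'g \<Rightarrow> 'g \<Rightarrow> 'g" where
  "brace_lambda B c b = (\<ominus>\<^bsub>B\<^esub> c) \<oplus>\<^bsub>B\<^esub> (c \<otimes>\<^bsub>B\<^esub> b)"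

definition brace_ideal :: "'g ring \<Rightarrow> 'g set \<Rightarrow> bool" where
  "brace_ideal B I \<longleftrightarrow> I \<lhd> add_monoid B \<and> I \<lhd> B \<and>
     (\<forall>c\<in>carrier B. brace_lambda B c ` I \<subseteq> I)"

definition linear_maps :: "'f ring \<Rightarrow> ('f, 'v) module \<Rightarrow> ('f, 'w) module \<Rightarrow> ('v \<Rightarrow> 'w) set" where
  "linear_maps F V W = {f \<in> carrier V \<rightarrow> carrier W.
     (\<forall>x\<in>carrier V. \<forall>y\<in>carrier V. f (x \<oplus>\<^bsub>V\<^esub> y) = f x \<oplus>\<^bsub>W\<^esub> f y) \<and>
     (\<forall>a\<in>carrier F. \<forall>x\<in>carrier V. f (a \<odot>\<^bsub>V\<^esub> x) = a \<odot>\<^bsub>W\<^esub> f x)}"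

definition GL :: "'f ring \<Rightarrow> ('f, 'v) module \<Rightarrow> ('v \<Rightarrow> 'v) monoid" where
  "GL F V = (BijGroup (carrier V)) \<lparr>carrier := Bij (carrier V) \<inter> linear_maps F V V\<rparr>"

text \<open>Over a field \<open>F\<close>, the locale predicate \<open>module F V\<close> says that \<open>V\<close> is an \<open>F\<close>-vector
  space (of arbitrary dimension).\<close>

definition group_rep :: "'f ring \<Rightarrow> 'g monoid \<Rightarrow> ('f, 'v) module \<Rightarrow> ('g \<Rightarrow> 'v \<Rightarrow> 'v) \<Rightarrow> bool" where
  "group_rep F G V \<rho> \<longleftrightarrow> field F \<and> module F V \<and> \<rho> \<in> hom G (GL F V)"

definition brace_rep :: "'f ring \<Rightarrow> 'g ring \<Rightarrow> ('f, 'v) module \<Rightarrow> ('g \<Rightarrow> 'v \<Rightarrow> 'v) \<Rightarrow> bool" where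
  "brace_rep F B V \<rho> \<longleftrightarrow> group_rep F (add_monoid B) V \<rho> \<and>
     brace_ideal B (kernel (add_monoid B) (GL F V) \<rho>)"


section \<open>Trifactorised groups and their representations\<close>

definition trifactorised_group :: "'g monoid \<Rightarrow> 'g set \<Rightarrow> 'g set \<Rightarrow> 'g set \<Rightarrow> bool" where
  "trifactorised_group G K H E \<longleftrightarrow> group G \<and> finite (carrier G) \<and>
     K \<lhd> G \<and> subgroup H G \<and> subgroup E G \<and>
     carrier G = K <#>\<^bsub>G\<^esub> H \<and> carrier G = K <#>\<^bsub>G\<^esub> E \<and> carrier G = H <#>\<^bsub>G\<^esub> E \<and>
     K \<inter> E = {\<one>\<^bsub>G\<^esub>} \<and> H \<inter> E = {\<one>\<^bsub>G\<^esub>}"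

text \<open>The brace has underlying set \<open>K \<subseteq> carrier G\<close>, its addition is the multiplication of \<open>G\<close>
  restricted to \<open>K\<close>, and its multiplication is a second, unrelated operation on \<open>K\<close>. As
  \<open>\<delta>\<close> is the identity map, \<open>\<delta>(c)\<eta>(c)\<close> becomes \<open>c \<otimes>\<^bsub>G\<^esub> \<eta> c\<close>.\<close>

definition associated_epi ::
  "'g ring \<Rightarrow> 'g monoid \<Rightarrow> 'g set \<Rightarrow> 'g set \<Rightarrow> 'g set \<Rightarrow> ('g \<Rightarrow> 'g) \<Rightarrow> bool" where
  "associated_epi B G K H E \<eta> \<longleftrightarrow>
     K = carrier B \<and> (\<forall>a\<in>K. \<forall>b\<in>K. a \<oplus>\<^bsub>B\<^esub> b = a \<otimes>\<^bsub>G\<^esub> b) \<and>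
     \<eta> \<in> hom B (G\<lparr>carrier := E\<rparr>) \<and> \<eta> ` carrier B = E \<and>
     (\<forall>c\<in>carrier B. \<forall>k\<in>K. \<eta> c \<otimes>\<^bsub>G\<^esub> k \<otimes>\<^bsub>G\<^esub> inv\<^bsub>G\<^esub> (\<eta> c) = brace_lambda B c k) \<and>
     H = {c \<otimes>\<^bsub>G\<^esub> \<eta> c | c. c \<in> carrier B}"

definition associated_trifactorised_group ::
  "'g ring \<Rightarrow> 'g monoid \<Rightarrow> 'g set \<Rightarrow> 'g set \<Rightarrow> 'g set \<Rightarrow> bool" where
  "associated_trifactorised_group B G K H E \<longleftrightarrow>
     trifactorised_group G K H E \<and> (\<exists>\<eta>. associated_epi B G K H E \<eta>)"

definition trifactorised_kernel :: "'g monoid \<Rightarrow> 'g set \<Rightarrow> 'g set \<Rightarrow> 'g set \<Rightarrow> 'g set \<Rightarrow> bool" where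
  "trifactorised_kernel G K H E N \<longleftrightarrow>
     N = ((N \<inter> K) <#>\<^bsub>G\<^esub> H) \<inter> ((N \<inter> K) <#>\<^bsub>G\<^esub> E)"

definition trifactorised_rep ::
  "'f ring \<Rightarrow> 'g monoid \<Rightarrow> 'g set \<Rightarrow> 'g set \<Rightarrow> 'g set \<Rightarrow> ('f, 'w) module \<Rightarrow> ('g \<Rightarrow> 'w \<Rightarrow> 'w) \<Rightarrow> bool"
where
  "trifactorised_rep F G K H E W \<tau> \<longleftrightarrow> group_rep F G W \<tau> \<and>
     trifactorised_kernel G K H E (kernel G (GL F W) \<tau>)"

definition internal_direct_sum ::
  "'f ring \<Rightarrow> ('f, 'w) module \<Rightarrow> 'i set \<Rightarrow> ('i \<Rightarrow> 'w set) \<Rightarrow> bool" where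
  "internal_direct_sum F W I U \<longleftrightarrow> finite I \<and> (\<forall>i\<in>I. submodule (U i) F W) \<and>
     (\<forall>w\<in>carrier W. \<exists>!f. f \<in> (\<Pi>\<^sub>E i\<in>I. U i) \<and> w = (\<Oplus>\<^bsub>W\<^esub>i\<in>I. f i))"

text \<open>For \<open>N\<close> the kernel of \<open>\<tau>\<close>, \<open>\<tau> e ` V\<^sub>0\<close> depends only on the coset of \<open>e\<close> modulo \<open>N\<close>.
  The quotient is the library's, with elements written as right cosets; since \<open>N\<close> is normal,
  these are the left cosets \<open>eN\<close>.\<close>

definition coset_translate ::
  "'g monoid \<Rightarrow> 'g set \<Rightarrow> 'g set \<Rightarrow> ('g \<Rightarrow> 'w \<Rightarrow> 'w) \<Rightarrow> 'w set \<Rightarrow> 'g set \<Rightarrow> 'w set" where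
  "coset_translate G E N \<tau> V\<^sub>0 C = \<tau> (SOME e. e \<in> E \<and> C = N #>\<^bsub>G\<^esub> e) ` V\<^sub>0"

definition induced_trifactorised_rep ::
  "'f ring \<Rightarrow> 'g monoid \<Rightarrow> 'g set \<Rightarrow> 'g set \<Rightarrow> 'g set \<Rightarrow> ('f, 'v) module \<Rightarrow> ('g \<Rightarrow> 'v \<Rightarrow> 'v) \<Rightarrow>
   ('f, 'w) module \<Rightarrow> ('g \<Rightarrow> 'w \<Rightarrow> 'w) \<Rightarrow> bool" where
  "induced_trifactorised_rep F G K H E V \<rho> W \<tau> \<longleftrightarrow>
     (let N = kernel G (GL F W) \<tau> in
        group_rep F G W \<tau> \<and> trifactorised_kernel G K H E N \<and>
        (\<exists>V\<^sub>0. submodule V\<^sub>0 F W \<and> (\<forall>k\<in>K. \<tau> k ` V\<^sub>0 \<subseteq> V\<^sub>0) \<and>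
           (\<exists>\<alpha>. \<alpha> \<in> linear_maps F V (W\<lparr>carrier := V\<^sub>0\<rparr>) \<and> bij_betw \<alpha> (carrier V) V\<^sub>0 \<and>
                (\<forall>k\<in>K. \<forall>v\<in>carrier V. \<tau> k (\<alpha> v) = \<alpha> (\<rho> k v))) \<and>
           internal_direct_sum F W
             (carrier ((G\<lparr>carrier := E <#>\<^bsub>G\<^esub> N\<rparr>) Mod N))
             (coset_translate G E N \<tau> V\<^sub>0)))"


section \<open>Group algebras of finite groups\<close>

definition group_algebra_basis :: "'f ring \<Rightarrow> 'g monoid \<Rightarrow> 'g \<Rightarrow> 'g \<Rightarrow> 'f" where
  "group_algebra_basis F G g = (\<lambda>x\<in>carrier G. if x = g then \<one>\<^bsub>F\<^esub> else \<zero>\<^bsub>F\<^esub>)"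

text \<open>No finite-support condition is imposed, so this is the group algebra only for finite \<open>G\<close>.\<close>

definition group_algebra :: "'f ring \<Rightarrow> 'g monoid \<Rightarrow> ('g \<Rightarrow> 'f) ring" where
  "group_algebra F G =
     \<lparr>carrier = carrier G \<rightarrow>\<^sub>E carrier F,
      monoid.mult = (\<lambda>a b. \<lambda>x\<in>carrier G. \<Oplus>\<^bsub>F\<^esub>y\<in>carrier G. a y \<otimes>\<^bsub>F\<^esub> b (inv\<^bsub>G\<^esub> y \<otimes>\<^bsub>G\<^esub> x)),
      one = group_algebra_basis F G \<one>\<^bsub>G\<^esub>,
      ring.zero = (\<lambda>x\<in>carrier G. \<zero>\<^bsub>F\<^esub>),
      ring.add = (\<lambda>a b. \<lambda>x\<in>carrier G. a x \<oplus>\<^bsub>F\<^esub> b x)\<rparr>"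

definition group_algebra_scale :: "'f ring \<Rightarrow> 'g monoid \<Rightarrow> 'f \<Rightarrow> ('g \<Rightarrow> 'f) \<Rightarrow> 'g \<Rightarrow> 'f" where
  "group_algebra_scale F G c a = (\<lambda>x\<in>carrier G. c \<otimes>\<^bsub>F\<^esub> a x)"

text \<open>The inclusion of \<open>FL\<close> into \<open>FG\<close> for a subgroup \<open>L\<close>, followed by right multiplication, makes
  \<open>FG\<close> a right \<open>FL\<close>-module.\<close>

definition group_algebra_incl :: "'f ring \<Rightarrow> 'g monoid \<Rightarrow> 'g set \<Rightarrow> ('g \<Rightarrow> 'f) \<Rightarrow> 'g \<Rightarrow> 'f" where
  "group_algebra_incl F G L s = (\<lambda>x\<in>carrier G. if x \<in> L then s x else \<zero>\<^bsub>F\<^esub>)"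

definition group_algebra_ract ::
  "'f ring \<Rightarrow> 'g monoid \<Rightarrow> 'g set \<Rightarrow> ('g \<Rightarrow> 'f) \<Rightarrow> ('g \<Rightarrow> 'f) \<Rightarrow> 'g \<Rightarrow> 'f" where
  "group_algebra_ract F G L a s = a \<otimes>\<^bsub>group_algebra F G\<^esub> group_algebra_incl F G L s"

text \<open>The left \<open>FL\<close>-module structure on \<open>V\<close> obtained from a representation of \<open>L\<close> on \<open>V\<close>.\<close>

definition group_algebra_lact ::
  "('f, 'v) module \<Rightarrow> 'g set \<Rightarrow> ('g \<Rightarrow> 'v \<Rightarrow> 'v) \<Rightarrow> ('g \<Rightarrow> 'f) \<Rightarrow> 'v \<Rightarrow> 'v" where
  "group_algebra_lact V L \<sigma> s v = (\<Oplus>\<^bsub>V\<^esub>x\<in>L. s x \<odot>\<^bsub>V\<^esub> \<sigma> x v)"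


section \<open>Tensor products over a noncommutative ring\<close>

text \<open>For a right \<open>S\<close>-module \<open>M\<close> and a left \<open>S\<close>-module \<open>N\<close>, with actions \<open>ra m s = m s\<close> and
  \<open>la s n = s n\<close>, the abelian group \<open>M \<otimes>\<^sub>S N\<close> is the free abelian group on \<open>M \<times> N\<close> modulo
  the relations of biadditivity and \<open>S\<close>-balance. The library writes free abelian groups as
  multiplicative groups of \<open>int\<close>-valued finitely supported functions.\<close>

definition tensor_free ::
  "('m, 'x) ring_scheme \<Rightarrow> ('n, 'y) ring_scheme \<Rightarrow> ('m \<times> 'n \<Rightarrow>\<^sub>0 int) monoid" where
  "tensor_free M N = free_Abelian_group (carrier M \<times> carrier N)"

definition tensor_rel ::
  "('s, 'z) ring_scheme \<Rightarrow> ('m, 'x) ring_scheme \<Rightarrow> ('n, 'y) ring_scheme \<Rightarrow>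
   ('m \<Rightarrow> 's \<Rightarrow> 'm) \<Rightarrow> ('s \<Rightarrow> 'n \<Rightarrow> 'n) \<Rightarrow> ('m \<times> 'n \<Rightarrow>\<^sub>0 int) set" where
  "tensor_rel S M N ra la = generate (tensor_free M N)
     ({frag_of (m \<oplus>\<^bsub>M\<^esub> m', n) - frag_of (m, n) - frag_of (m', n) | m m' n.
         m \<in> carrier M \<and> m' \<in> carrier M \<and> n \<in> carrier N} \<union>
      {frag_of (m, n \<oplus>\<^bsub>N\<^esub> n') - frag_of (m, n) - frag_of (m, n') | m n n'.
         m \<in> carrier M \<and> n \<in> carrier N \<and> n' \<in> carrier N} \<union>
      {frag_of (ra m s, n) - frag_of (m, la s n) | m s n.
         m \<in> carrier M \<and> s \<in> carrier S \<and> n \<in> carrier N})"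

definition tensor_group ::
  "('s, 'z) ring_scheme \<Rightarrow> ('m, 'x) ring_scheme \<Rightarrow> ('n, 'y) ring_scheme \<Rightarrow>
   ('m \<Rightarrow> 's \<Rightarrow> 'm) \<Rightarrow> ('s \<Rightarrow> 'n \<Rightarrow> 'n) \<Rightarrow> ('m \<times> 'n \<Rightarrow>\<^sub>0 int) set monoid" where
  "tensor_group S M N ra la = tensor_free M N Mod tensor_rel S M N ra la"

definition pure_tensor ::
  "('s, 'z) ring_scheme \<Rightarrow> ('m, 'x) ring_scheme \<Rightarrow> ('n, 'y) ring_scheme \<Rightarrow>
   ('m \<Rightarrow> 's \<Rightarrow> 'm) \<Rightarrow> ('s \<Rightarrow> 'n \<Rightarrow> 'n) \<Rightarrow> 'm \<Rightarrow> 'n \<Rightarrow> ('m \<times> 'n \<Rightarrow>\<^sub>0 int) set" where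
  "pure_tensor S M N ra la m n = tensor_rel S M N ra la #>\<^bsub>tensor_free M N\<^esub> frag_of (m, n)"

text \<open>The endomorphism \<open>f \<otimes> id\<close> of \<open>M \<otimes>\<^sub>S N\<close> induced by an endomorphism \<open>f\<close> of the right
  \<open>S\<close>-module \<open>M\<close>: extend \<open>(m, n) \<mapsto> (f m, n)\<close> additively to the free abelian group and pass to
  cosets. All members of the union coincide when \<open>f\<close> is additive and commutes with the right
  action.\<close>

definition tensor_map ::
  "('s, 'z) ring_scheme \<Rightarrow> ('m, 'x) ring_scheme \<Rightarrow> ('n, 'y) ring_scheme \<Rightarrow>
   ('m \<Rightarrow> 's \<Rightarrow> 'm) \<Rightarrow> ('s \<Rightarrow> 'n \<Rightarrow> 'n) \<Rightarrow> ('m \<Rightarrow> 'm) \<Rightarrow>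
   ('m \<times> 'n \<Rightarrow>\<^sub>0 int) set \<Rightarrow> ('m \<times> 'n \<Rightarrow>\<^sub>0 int) set" where
  "tensor_map S M N ra la f = (\<lambda>C\<in>carrier (tensor_group S M N ra la).
     \<Union>x\<in>C. tensor_rel S M N ra la #>\<^bsub>tensor_free M N\<^esub>
              frag_extend (\<lambda>(m, n). frag_of (f m, n)) x)"


section \<open>The induced module \<open>FG \<otimes>\<^bsub>FL\<^esub> V\<close>\<close>

text \<open>Here \<open>\<sigma>\<close> is a representation of the subgroup \<open>L\<close> of \<open>G\<close> on \<open>V\<close>. The scalars act by
  \<open>c (\<omega> \<otimes> v) = c\<omega> \<otimes> v\<close>. The fields \<open>mult\<close> and \<open>one\<close> of a module record carry no meaning.\<close>

type_synonym ('g, 'f, 'v) ind_space = "(('g \<Rightarrow> 'f) \<times> 'v \<Rightarrow>\<^sub>0 int) set"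

definition ind_tensor ::
  "'f ring \<Rightarrow> 'g monoid \<Rightarrow> 'g set \<Rightarrow> ('f, 'v) module \<Rightarrow> ('g \<Rightarrow> 'v \<Rightarrow> 'v) \<Rightarrow>
   ('g \<Rightarrow> 'f) \<Rightarrow> 'v \<Rightarrow> ('g, 'f, 'v) ind_space" where
  "ind_tensor F G L V \<sigma> = pure_tensor (group_algebra F (G\<lparr>carrier := L\<rparr>)) (group_algebra F G) V
     (group_algebra_ract F G L) (group_algebra_lact V L \<sigma>)"

definition ind_map ::
  "'f ring \<Rightarrow> 'g monoid \<Rightarrow> 'g set \<Rightarrow> ('f, 'v) module \<Rightarrow> ('g \<Rightarrow> 'v \<Rightarrow> 'v) \<Rightarrow>
   (('g \<Rightarrow> 'f) \<Rightarrow> 'g \<Rightarrow> 'f) \<Rightarrow> ('g, 'f, 'v) ind_space \<Rightarrow> ('g, 'f, 'v) ind_space" where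
  "ind_map F G L V \<sigma> = tensor_map (group_algebra F (G\<lparr>carrier := L\<rparr>)) (group_algebra F G) V
     (group_algebra_ract F G L) (group_algebra_lact V L \<sigma>)"

definition ind_module ::
  "'f ring \<Rightarrow> 'g monoid \<Rightarrow> 'g set \<Rightarrow> ('f, 'v) module \<Rightarrow> ('g \<Rightarrow> 'v \<Rightarrow> 'v) \<Rightarrow>
   ('f, ('g, 'f, 'v) ind_space) module" where
  "ind_module F G L V \<sigma> =
     (let A = tensor_group (group_algebra F (G\<lparr>carrier := L\<rparr>)) (group_algebra F G) V
                (group_algebra_ract F G L) (group_algebra_lact V L \<sigma>)
      in \<lparr>carrier = carrier A, monoid.mult = undefined, one = undefined,
          ring.zero = \<one>\<^bsub>A\<^esub>, ring.add = monoid.mult A,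
          smult = (\<lambda>c. ind_map F G L V \<sigma> (group_algebra_scale F G c))\<rparr>)"

definition ind_rep ::
  "'f ring \<Rightarrow> 'g monoid \<Rightarrow> 'g set \<Rightarrow> ('f, 'v) module \<Rightarrow> ('g \<Rightarrow> 'v \<Rightarrow> 'v) \<Rightarrow>
   'g \<Rightarrow> ('g, 'f, 'v) ind_space \<Rightarrow> ('g, 'f, 'v) ind_space" where
  "ind_rep F G L V \<sigma> g = ind_map F G L V \<sigma>
     (\<lambda>\<omega>. group_algebra_basis F G g \<otimes>\<^bsub>group_algebra F G\<^esub> \<omega>)"

text \<open>The action \<open>(kt) \<cdot> v = \<rho>(k)(v)\<close> of \<open>KT\<close> on \<open>V\<close>; the choice of \<open>k\<close> is immaterial when
  \<open>T \<inter> K\<close> is the kernel of \<open>\<rho>\<close>.\<close>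

definition extended_action ::
  "'g monoid \<Rightarrow> 'g set \<Rightarrow> 'g set \<Rightarrow> ('g \<Rightarrow> 'v \<Rightarrow> 'v) \<Rightarrow> 'g \<Rightarrow> 'v \<Rightarrow> 'v" where
  "extended_action G K T \<rho> x = \<rho> (SOME k. k \<in> K \<and> (\<exists>t\<in>T. x = k \<otimes>\<^bsub>G\<^esub> t))"

end

theory Submission
  imports Defs
begin

text \<open>Let \<open>I\<close> be the kernel of \<open>\<rho>\<close>. An element \<open>i c \<eta>(c) = j \<eta>(d)\<close> of \<open>IH \<inter> IE\<close> has
  \<open>\<eta>(c) = \<eta>(d)\<close> and \<open>c \<in> I\<close> because \<open>K \<inter> E = 1\<close>; hence \<open>T = I \<eta>(I)\<close>, which gives the normality
  of \<open>T\<close>, \<open>T \<inter> K = I\<close> and \<open>E \<inter> KT \<subseteq> T\<close>. So representatives in \<open>E\<close> of \<open>ET/T\<close> form a left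
  transversal of \<open>L = KT\<close> in \<open>G\<close>.

  For a left transversal \<open>r\<^sub>i\<close> of \<open>L\<close>, the maps \<open>\<omega> \<otimes> v \<mapsto> \<Sum>\<^sub>l \<omega>(r\<^sub>i l) \<sigma>(l) v\<close> are balanced, and
  they are the coordinates of \<open>W\<close> with respect to the summands \<open>r\<^sub>i \<otimes> V\<close>. They yield the direct
  sum decomposition and show that \<open>g\<close> can fix \<open>1 \<otimes> V\<close> pointwise only if \<open>g \<in> L\<close> acts trivially
  on \<open>V\<close>, that is \<open>g \<in> T\<close>; conversely \<open>T\<close> acts trivially because it is normal. When \<open>V = 0\<close> this
  argument is void, but then \<open>I = K\<close> and \<open>T = G\<close>.\<close>

section \<open>Tensor products\<close>

text \<open>The tensor product is given by generators and relations. Identities in it are checked on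
  pure tensors, but injectivity and independence only become visible through homomorphisms out of
  it; hence the effort spent on proving that the coordinate maps are balanced, the one calculation
  with double sums. Scalars act on W through the factor FG. That they agree with the scalars of V on
  1 \<otimes> V is again an instance of balance, for multiples of the identity of FL. The normality
  of T draws on all three clauses in the definition of an ideal: K conjugates I into itself by
  additive normality, E does so by lambda-invariance, and both conjugations of \<eta>(I) rest on
  normality in the multiplicative group. The direct sum in (IR2) is indexed by cosets of the kernel
  of the induced representation, so this kernel must be known to be T before that condition can be
  brought into a usable form.\<close>

locale balanced_tensor = M: abelian_group M + N: abelian_group N
  for S :: "('s, 'z) ring_scheme" and M :: "('m, 'x) ring_scheme" and N :: "('n, 'y) ring_scheme"
    and ra :: "'m \<Rightarrow> 's \<Rightarrow> 'm" and la :: "'s \<Rightarrow> 'n \<Rightarrow> 'n" +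
  assumes ra_closed: "\<lbrakk>m \<in> carrier M; s \<in> carrier S\<rbrakk> \<Longrightarrow> ra m s \<in> carrier M"
    and la_closed: "\<lbrakk>s \<in> carrier S; n \<in> carrier N\<rbrakk> \<Longrightarrow> la s n \<in> carrier N"
begin

abbreviation "free \<equiv> tensor_free M N"
abbreviation "rel \<equiv> tensor_rel S M N ra la"
abbreviation "tensor \<equiv> tensor_group S M N ra la"
abbreviation "pure \<equiv> pure_tensor S M N ra la"

text \<open>Names the generating set that \<open>tensor_rel\<close> leaves anonymous, so that a
  homomorphism can be tested on it one generator at a time.\<close>

definition rel_gens :: "('m \<times> 'n \<Rightarrow>\<^sub>0 int) set" where
  "rel_gens =
     {frag_of (m \<oplus>\<^bsub>M\<^esub> m', n) - frag_of (m, n) - frag_of (m', n) | m m' n.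
         m \<in> carrier M \<and> m' \<in> carrier M \<and> n \<in> carrier N} \<union>
      {frag_of (m, n \<oplus>\<^bsub>N\<^esub> n') - frag_of (m, n) - frag_of (m, n') | m n n'.
         m \<in> carrier M \<and> n \<in> carrier N \<and> n' \<in> carrier N} \<union>
      {frag_of (ra m s, n) - frag_of (m, la s n) | m s n.
         m \<in> carrier M \<and> s \<in> carrier S \<and> n \<in> carrier N}"

lemma rel_eq: "rel = generate free rel_gens"
  unfolding tensor_rel_def rel_gens_def ..

lemma comm_group_free: "comm_group free"
  by (simp add: tensor_free_def abelian_free_Abelian_group)

lemma carrier_free [simp]: "x \<in> carrier free \<longleftrightarrow> Poly_Mapping.keys x \<subseteq> carrier M \<times> carrier N"
  by (simp add: tensor_free_def)

lemma mult_free [simp]: "x \<otimes>\<^bsub>free\<^esub> y = x + y"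
  by (simp add: tensor_free_def)

lemma one_free [simp]: "\<one>\<^bsub>free\<^esub> = 0"
  by (simp add: tensor_free_def)

interpretation FR: comm_group free by (rule comm_group_free)

lemma diff_closed_free:
  "\<lbrakk>x \<in> carrier free; y \<in> carrier free\<rbrakk> \<Longrightarrow> x - y \<in> carrier free"
  using keys_diff[of x y] unfolding carrier_free by blast

lemma frag_of_closed_free: "\<lbrakk>m \<in> carrier M; n \<in> carrier N\<rbrakk> \<Longrightarrow> frag_of (m, n) \<in> carrier free"
  by simp

lemma rel_gens_subset: "rel_gens \<subseteq> carrier free"
  unfolding rel_gens_def
  by (auto intro!: diff_closed_free frag_of_closed_free ra_closed la_closed simp del: carrier_free)

lemma subgroup_rel: "subgroup rel free"
  unfolding rel_eq by (rule FR.generate_is_subgroup[OF rel_gens_subset])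

lemma normal_rel: "rel \<lhd> free"
  by (rule FR.subgroup_imp_normal[OF subgroup_rel])

interpretation NR: normal rel free by (rule normal_rel)

lemma comm_group_tensor: "comm_group tensor"
  unfolding tensor_group_def by (rule FR.abelian_FactGroup[OF subgroup_rel])

interpretation T: comm_group tensor by (rule comm_group_tensor)

lemma coset_hom: "(\<lambda>x. rel #>\<^bsub>free\<^esub> x) \<in> hom free tensor"
  unfolding tensor_group_def by (rule NR.r_coset_hom_Mod)

lemma carrier_tensor: "carrier tensor = (\<lambda>x. rel #>\<^bsub>free\<^esub> x) ` carrier free"
  unfolding tensor_group_def by (rule carrier_FactGroup)

lemma one_tensor: "\<one>\<^bsub>tensor\<^esub> = rel"
  unfolding tensor_group_def by simp

lemma coset_rel: "x \<in> rel \<Longrightarrow> rel #>\<^bsub>free\<^esub> x = \<one>\<^bsub>tensor\<^esub>"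
  unfolding one_tensor by (simp add: FR.coset_join2 NR.mem_carrier subgroup_rel del: carrier_free)

text \<open>The relations are written with subtraction of finitely supported functions, while the
  target \<open>A\<close> is multiplicative; the product form keeps inverses in \<open>A\<close> out
  of sight.\<close>

lemma hom_free_diff:
  fixes A :: "('q, 'r) monoid_scheme"
  assumes "group A" and h: "h \<in> hom free A" and x: "x \<in> carrier free" and y: "y \<in> carrier free"
  shows "h (x - y) \<otimes>\<^bsub>A\<^esub> h y = h x"
  using hom_mult[OF h diff_closed_free[OF x y] y] by simp

text \<open>The shape \<open>x - y - z\<close> is that of the two families of biadditivity
  generators; \<open>hom_free_eqI2\<close> serves the balance generators.\<close>

lemma hom_free_eqI:
  fixes A :: "('q, 'r) monoid_scheme"
  assumes A: "group A" and h: "h \<in> hom free A" and x: "x \<in> carrier free" and y: "y \<in> carrier free"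
    and z: "z \<in> carrier free" and "h x = h y \<otimes>\<^bsub>A\<^esub> h z"
  shows "h (x - y - z) = \<one>\<^bsub>A\<^esub>"
proof -
  interpret A: group A by fact
  have c: "h u \<in> carrier A" if "u \<in> carrier free" for u using h that by (auto simp: hom_def)
  have yz: "y + z \<in> carrier free" using FR.m_closed[OF y z] by simp
  have "h (x - (y + z)) \<otimes>\<^bsub>A\<^esub> h (y + z) = h (y + z)"
    using hom_free_diff[OF A h x yz] assms(6) hom_mult[OF h y z] by simp
  then have "h (x - (y + z)) = \<one>\<^bsub>A\<^esub>"
    using A.r_cancel_one[OF c[OF yz] c[OF diff_closed_free[OF x yz]]] by blast
  then show ?thesis by (simp add: diff_diff_eq)
qed

lemma hom_free_eqI2:
  fixes A :: "('q, 'r) monoid_scheme"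
  assumes A: "group A" and h: "h \<in> hom free A" and x: "x \<in> carrier free" and y: "y \<in> carrier free"
    and "h x = h y"
  shows "h (x - y) = \<one>\<^bsub>A\<^esub>"
proof -
  interpret A: group A by fact
  have c: "h u \<in> carrier A" if "u \<in> carrier free" for u using h that by (auto simp: hom_def)
  show ?thesis
    using hom_free_diff[OF A h x y] assms(5) A.r_cancel_one[OF c[OF y] c[OF diff_closed_free[OF x y]]] by simp
qed

lemma pure_eq: "pure m n = rel #>\<^bsub>free\<^esub> frag_of (m, n)"
  by (simp add: pure_tensor_def)

lemma pure_closed: "\<lbrakk>m \<in> carrier M; n \<in> carrier N\<rbrakk> \<Longrightarrow> pure m n \<in> carrier tensor"
  by (simp add: pure_eq carrier_tensor)

lemma coset_diff3:
  assumes "x \<in> carrier free" "y \<in> carrier free" "z \<in> carrier free" "x - y - z \<in> rel"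
  shows "rel #>\<^bsub>free\<^esub> x = (rel #>\<^bsub>free\<^esub> y) \<otimes>\<^bsub>tensor\<^esub> (rel #>\<^bsub>free\<^esub> z)"
proof -
  have yz: "y + z \<in> carrier free" using FR.m_closed[OF assms(2,3)] by simp
  have d: "x - (y + z) \<in> carrier free" by (rule diff_closed_free[OF assms(1) yz])
  have "rel #>\<^bsub>free\<^esub> ((x - (y + z)) + (y + z)) = (rel #>\<^bsub>free\<^esub> (x - (y + z))) \<otimes>\<^bsub>tensor\<^esub> (rel #>\<^bsub>free\<^esub> (y + z))"
    using hom_mult[OF coset_hom d yz] by simp
  also have "rel #>\<^bsub>free\<^esub> (x - (y + z)) = \<one>\<^bsub>tensor\<^esub>"
    using assms(4) by (simp add: coset_rel diff_diff_eq)
  also have "rel #>\<^bsub>free\<^esub> (y + z) = (rel #>\<^bsub>free\<^esub> y) \<otimes>\<^bsub>tensor\<^esub> (rel #>\<^bsub>free\<^esub> z)"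
    using hom_mult[OF coset_hom assms(2,3)] by simp
  finally show ?thesis
    using hom_in_carrier[OF coset_hom] assms by (simp del: carrier_free)
qed

lemma coset_diff2:
  assumes "x \<in> carrier free" "y \<in> carrier free" "x - y \<in> rel"
  shows "rel #>\<^bsub>free\<^esub> x = rel #>\<^bsub>free\<^esub> y"
proof -
  have "rel #>\<^bsub>free\<^esub> ((x - y) + y) = (rel #>\<^bsub>free\<^esub> (x - y)) \<otimes>\<^bsub>tensor\<^esub> (rel #>\<^bsub>free\<^esub> y)"
    using hom_mult[OF coset_hom diff_closed_free[OF assms(1,2)] assms(2)] by simp
  then show ?thesis
    using hom_in_carrier[OF coset_hom] assms by (simp del: carrier_free add: coset_rel)
qed

lemma rel_genI: "x \<in> rel_gens \<Longrightarrow> x \<in> rel"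
  unfolding rel_eq by (rule generate.incl)

lemma pure_add_left:
  assumes "m \<in> carrier M" "m' \<in> carrier M" "n \<in> carrier N"
  shows "pure (m \<oplus>\<^bsub>M\<^esub> m') n = pure m n \<otimes>\<^bsub>tensor\<^esub> pure m' n"
  unfolding pure_eq using assms
  by (intro coset_diff3 rel_genI) (auto simp: rel_gens_def)

lemma pure_add_right:
  assumes "m \<in> carrier M" "n \<in> carrier N" "n' \<in> carrier N"
  shows "pure m (n \<oplus>\<^bsub>N\<^esub> n') = pure m n \<otimes>\<^bsub>tensor\<^esub> pure m n'"
  unfolding pure_eq using assms
  by (intro coset_diff3 rel_genI) (auto simp: rel_gens_def)

lemma pure_balanced:
  assumes "m \<in> carrier M" "s \<in> carrier S" "n \<in> carrier N"
  shows "pure (ra m s) n = pure m (la s n)"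
  unfolding pure_eq using assms
  by (intro coset_diff2 rel_genI) (auto simp: rel_gens_def ra_closed la_closed)

lemma pure_zero_left: "n \<in> carrier N \<Longrightarrow> pure \<zero>\<^bsub>M\<^esub> n = \<one>\<^bsub>tensor\<^esub>"
  using pure_add_left[of "\<zero>\<^bsub>M\<^esub>" "\<zero>\<^bsub>M\<^esub>" n] pure_closed[of "\<zero>\<^bsub>M\<^esub>" n] T.l_cancel_one by simp

lemma pure_minus_left:
  assumes "m \<in> carrier M" "n \<in> carrier N"
  shows "pure (\<ominus>\<^bsub>M\<^esub> m) n = inv\<^bsub>tensor\<^esub> pure m n"
  using pure_add_left[of "\<ominus>\<^bsub>M\<^esub> m" m n] assms
  by (intro T.inv_equality[symmetric]) (auto simp: pure_closed pure_zero_left M.l_neg)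

text \<open>There is no case for inverses because the inverse of a pure tensor is again pure, by
  \<open>pure_minus_left\<close>.\<close>

lemma tensor_induct [consumes 1, case_names pure mult]:
  assumes "w \<in> carrier tensor"
    and P: "\<And>m n. \<lbrakk>m \<in> carrier M; n \<in> carrier N\<rbrakk> \<Longrightarrow> P (pure m n)"
    and m: "\<And>a b. \<lbrakk>a \<in> carrier tensor; b \<in> carrier tensor; P a; P b\<rbrakk> \<Longrightarrow> P (a \<otimes>\<^bsub>tensor\<^esub> b)"
  shows "P w"
proof -
  let ?q = "\<lambda>x. rel #>\<^bsub>free\<^esub> x"
  have q: "?q x \<in> carrier tensor" if "x \<in> carrier free" for x
    using that carrier_tensor by auto
  obtain x where x: "Poly_Mapping.keys x \<subseteq> carrier M \<times> carrier N" and w: "w = ?q x"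
    using assms(1) by (auto simp: carrier_tensor)
  \<comment> \<open>The induction on the free group passes through differences, so the claim is
    carried along for the inverse as well.\<close>
  have "P (?q x) \<and> P (inv\<^bsub>tensor\<^esub> ?q x)"
    using x
  proof (induction rule: free_Abelian_group_induct[consumes 1, case_names zero diff gen])
    case zero
    have "P \<one>\<^bsub>tensor\<^esub>" using P[of "\<zero>\<^bsub>M\<^esub>" "\<zero>\<^bsub>N\<^esub>"] by (simp add: pure_zero_left)
    moreover have "?q 0 = \<one>\<^bsub>tensor\<^esub>"
      using coset_rel[OF subgroup.one_closed[OF subgroup_rel]] by simp
    ultimately show ?case by simp
  next
    case (diff x y)
    then have c: "x \<in> carrier free" "y \<in> carrier free" by simp_all
    have "?q (x - y) \<otimes>\<^bsub>tensor\<^esub> ?q y = ?q x"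
      by (rule hom_free_diff[OF T.is_group coset_hom c])
    then have e: "?q (x - y) = ?q x \<otimes>\<^bsub>tensor\<^esub> inv\<^bsub>tensor\<^esub> ?q y"
      using T.inv_solve_right[OF q[OF diff_closed_free[OF c]] q[OF c(1)] q[OF c(2)]] by simp
    then have "inv\<^bsub>tensor\<^esub> ?q (x - y) = ?q y \<otimes>\<^bsub>tensor\<^esub> inv\<^bsub>tensor\<^esub> ?q x"
      using q[OF c(1)] q[OF c(2)] by (simp add: T.inv_mult_group)
    with e show ?case using diff q[OF c(1)] q[OF c(2)] by (auto intro!: m)
  next
    case (gen a)
    then obtain i j where a: "a = (i, j)" "i \<in> carrier M" "j \<in> carrier N" by auto
    then show ?case using P[of i j] P[of "\<ominus>\<^bsub>M\<^esub> i" j] by (simp add: pure_eq[symmetric] pure_minus_left)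
  qed
  then show ?thesis by (simp add: w)
qed

text \<open>The kernel of \<open>h\<close> is a subgroup, so it contains \<open>rel\<close> as soon
  as it contains the generators, and \<open>h\<close> is then constant on cosets. This serves both
  maps given on pure tensors (\<open>tensor_universal\<close>) and maps induced by an endomorphism
  of \<open>M\<close> (\<open>tensor_map\<close>).\<close>

lemma hom_factors:
  fixes A :: "('q, 'r) monoid_scheme"
  assumes A: "comm_group A" and h: "h \<in> hom free A"
    and gens: "\<And>x. x \<in> rel_gens \<Longrightarrow> h x = \<one>\<^bsub>A\<^esub>"
  obtains g where "g \<in> hom tensor A" "\<And>x. x \<in> carrier free \<Longrightarrow> g (rel #>\<^bsub>free\<^esub> x) = h x"
proof -
  interpret A: comm_group A by fact
  interpret h: group_hom free A h
    by (simp add: group_hom_def group_hom_axioms_def h FR.is_group A.is_group)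
  have "rel \<subseteq> kernel free A h"
    unfolding rel_eq by (rule FR.generate_subgroup_incl[OF _ h.subgroup_kernel])
      (use gens rel_gens_subset in \<open>auto simp: kernel_def simp del: carrier_free\<close>)
  then have k: "h z = \<one>\<^bsub>A\<^esub>" if "z \<in> rel" for z using that by (auto simp: kernel_def)
  have "h x = h y" if x: "x \<in> carrier free" and y: "y \<in> carrier free"
    and e: "rel #>\<^bsub>free\<^esub> x = rel #>\<^bsub>free\<^esub> y" for x y
  proof -
    have "x \<in> rel #>\<^bsub>free\<^esub> y" using FR.rcos_self[OF x subgroup_rel] e by simp
    then obtain z where z: "z \<in> rel" "x = z \<otimes>\<^bsub>free\<^esub> y" by (auto simp: r_coset_def)
    then have "h x = h z \<otimes>\<^bsub>A\<^esub> h y" using h.hom_mult[OF NR.mem_carrier[OF z(1)] y] by simp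
    then show ?thesis using k[OF z(1)] h.hom_closed[OF y] by simp
  qed
  then show ?thesis
    using FactGroup_universal[OF h normal_rel, unfolded tensor_group_def[symmetric]] that by blast
qed

text \<open>The three identities between values on \<open>frag_of\<close> correspond to the three
  families of generators in \<open>rel_gens\<close>.\<close>

lemma hom_kills_gens:
  fixes A :: "('q, 'r) monoid_scheme"
  assumes A: "group A" and h: "h \<in> hom free A"
    and addl: "\<And>m m' n. \<lbrakk>m \<in> carrier M; m' \<in> carrier M; n \<in> carrier N\<rbrakk> \<Longrightarrow>
      h (frag_of (m \<oplus>\<^bsub>M\<^esub> m', n)) = h (frag_of (m, n)) \<otimes>\<^bsub>A\<^esub> h (frag_of (m', n))"
    and addr: "\<And>m n n'. \<lbrakk>m \<in> carrier M; n \<in> carrier N; n' \<in> carrier N\<rbrakk> \<Longrightarrow>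
      h (frag_of (m, n \<oplus>\<^bsub>N\<^esub> n')) = h (frag_of (m, n)) \<otimes>\<^bsub>A\<^esub> h (frag_of (m, n'))"
    and bal: "\<And>m s n. \<lbrakk>m \<in> carrier M; s \<in> carrier S; n \<in> carrier N\<rbrakk> \<Longrightarrow>
      h (frag_of (ra m s, n)) = h (frag_of (m, la s n))"
    and "x \<in> rel_gens"
  shows "h x = \<one>\<^bsub>A\<^esub>"
  using assms(6) unfolding rel_gens_def Un_iff mem_Collect_eq
proof (elim disjE exE conjE)
  fix m m' n assume "m \<in> carrier M" "m' \<in> carrier M" "n \<in> carrier N"
    and "x = frag_of (m \<oplus>\<^bsub>M\<^esub> m', n) - frag_of (m, n) - frag_of (m', n)"
  then show ?thesis by (auto intro!: hom_free_eqI[OF A h] addl)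
next
  fix m n n' assume "m \<in> carrier M" "n \<in> carrier N" "n' \<in> carrier N"
    and "x = frag_of (m, n \<oplus>\<^bsub>N\<^esub> n') - frag_of (m, n) - frag_of (m, n')"
  then show ?thesis by (auto intro!: hom_free_eqI[OF A h] addr)
next
  fix m s n assume "m \<in> carrier M" "s \<in> carrier S" "n \<in> carrier N"
    and "x = frag_of (ra m s, n) - frag_of (m, la s n)"
  then show ?thesis by (auto intro!: hom_free_eqI2[OF A h] bal ra_closed la_closed)
qed

theorem tensor_universal:
  fixes A :: "('q, 'r) monoid_scheme" and \<phi> :: "'m \<Rightarrow> 'n \<Rightarrow> 'q"
  assumes A: "comm_group A"
    and closed: "\<And>m n. \<lbrakk>m \<in> carrier M; n \<in> carrier N\<rbrakk> \<Longrightarrow> \<phi> m n \<in> carrier A"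
    and addl: "\<And>m m' n. \<lbrakk>m \<in> carrier M; m' \<in> carrier M; n \<in> carrier N\<rbrakk> \<Longrightarrow>
      \<phi> (m \<oplus>\<^bsub>M\<^esub> m') n = \<phi> m n \<otimes>\<^bsub>A\<^esub> \<phi> m' n"
    and addr: "\<And>m n n'. \<lbrakk>m \<in> carrier M; n \<in> carrier N; n' \<in> carrier N\<rbrakk> \<Longrightarrow>
      \<phi> m (n \<oplus>\<^bsub>N\<^esub> n') = \<phi> m n \<otimes>\<^bsub>A\<^esub> \<phi> m n'"
    and bal: "\<And>m s n. \<lbrakk>m \<in> carrier M; s \<in> carrier S; n \<in> carrier N\<rbrakk> \<Longrightarrow>
      \<phi> (ra m s) n = \<phi> m (la s n)"
  obtains g where "g \<in> hom tensor A"
    "\<And>m n. \<lbrakk>m \<in> carrier M; n \<in> carrier N\<rbrakk> \<Longrightarrow> g (pure m n) = \<phi> m n"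
proof -
  interpret A: comm_group A by fact
  have "(\<lambda>(m, n). \<phi> m n) ` (carrier M \<times> carrier N) \<subseteq> carrier A"
    using closed by auto
  then obtain h where h: "h \<in> hom free A"
    and hf: "\<And>x. x \<in> carrier M \<times> carrier N \<Longrightarrow> h (frag_of x) = (\<lambda>(m, n). \<phi> m n) x"
    unfolding tensor_free_def by (rule A.free_Abelian_group_universal) blast
  have hp: "h (frag_of (m, n)) = \<phi> m n" if "m \<in> carrier M" "n \<in> carrier N" for m n
    using hf[of "(m, n)"] that by simp
  have "h x = \<one>\<^bsub>A\<^esub>" if "x \<in> rel_gens" for x
    by (rule hom_kills_gens[OF A.is_group h _ _ _ that]) (simp_all add: hp addl addr bal ra_closed la_closed)
  then obtain g where "g \<in> hom tensor A" "\<And>x. x \<in> carrier free \<Longrightarrow> g (rel #>\<^bsub>free\<^esub> x) = h x"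
    using hom_factors[OF A h] by blast
  then show ?thesis using that by (simp add: pure_eq hp)
qed

text \<open>The conditions on \<open>f\<close> make \<open>(m, n)\<close> \<mapsto>
  \<open>pure (f m) n\<close> biadditive and balanced, so \<open>hom_factors\<close> provides a
  homomorphism \<open>g\<close>; what remains is to identify the union in the definition of
  \<open>tensor_map\<close> with \<open>g\<close>.\<close>

lemma tensor_map:
  assumes fc: "\<And>m. m \<in> carrier M \<Longrightarrow> f m \<in> carrier M"
    and fa: "\<And>m m'. \<lbrakk>m \<in> carrier M; m' \<in> carrier M\<rbrakk> \<Longrightarrow> f (m \<oplus>\<^bsub>M\<^esub> m') = f m \<oplus>\<^bsub>M\<^esub> f m'"
    and fr: "\<And>m s. \<lbrakk>m \<in> carrier M; s \<in> carrier S\<rbrakk> \<Longrightarrow> f (ra m s) = ra (f m) s"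
  shows tensor_map_hom: "tensor_map S M N ra la f \<in> hom tensor tensor"
    and tensor_map_pure: "\<lbrakk>m \<in> carrier M; n \<in> carrier N\<rbrakk> \<Longrightarrow>
      tensor_map S M N ra la f (pure m n) = pure (f m) n"
proof -
  let ?e = "frag_extend (\<lambda>(m, n). frag_of (f m, n))"
  have ec: "?e x \<in> carrier free" if "x \<in> carrier free" for x
  proof -
    have "Poly_Mapping.keys (?e x) \<subseteq> (\<Union>p\<in>Poly_Mapping.keys x. Poly_Mapping.keys ((\<lambda>(m, n). frag_of (f m, n)) p))"
      by (rule keys_frag_extend)
    also have "\<dots> \<subseteq> carrier M \<times> carrier N" using that fc by auto
    finally show ?thesis by simp
  qed
  have eh: "?e \<in> hom free free"
    by (rule homI) (use ec in \<open>simp_all add: frag_extend_add\<close>)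
  have h: "(\<lambda>x. rel #>\<^bsub>free\<^esub> ?e x) \<in> hom free tensor"
    using hom_compose[OF eh coset_hom] by (simp add: o_def)
  have "rel #>\<^bsub>free\<^esub> ?e x = \<one>\<^bsub>tensor\<^esub>" if "x \<in> rel_gens" for x
    by (rule hom_kills_gens[OF T.is_group h _ _ _ that])
      (simp_all add: pure_eq[symmetric] pure_add_left pure_add_right pure_balanced fc fa fr)
  then obtain g where g: "g \<in> hom tensor tensor"
    and gx: "\<And>x. x \<in> carrier free \<Longrightarrow> g (rel #>\<^bsub>free\<^esub> x) = rel #>\<^bsub>free\<^esub> ?e x"
    using hom_factors[OF comm_group_tensor h] by blast
  have tg: "tensor_map S M N ra la f C = g C" if C: "C \<in> carrier tensor" for C
  proof -
    obtain x where x: "x \<in> carrier free" "C = rel #>\<^bsub>free\<^esub> x" using C by (auto simp: carrier_tensor)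
    have "rel #>\<^bsub>free\<^esub> ?e y = g C" if y: "y \<in> C" for y
    proof -
      have "rel #>\<^bsub>free\<^esub> x = rel #>\<^bsub>free\<^esub> y"
        using FR.repr_independence[OF _ x(1) subgroup_rel] y x(2) by simp
      moreover have "y \<in> carrier free" using y x FR.r_coset_subset_G[OF NR.subset x(1)] by (auto simp del: carrier_free)
      ultimately show ?thesis using gx x by simp
    qed
    \<comment> \<open>All members of the union equal \<open>g C\<close>; since \<open>C\<close> is
      nonempty, so does the union.\<close>
    moreover have "x \<in> C" using FR.rcos_self[OF x(1) subgroup_rel] x(2) by simp
    ultimately show ?thesis using C by (auto simp: tensor_map_def)
  qed
  show "tensor_map S M N ra la f \<in> hom tensor tensor"
    by (rule homI) (use g T.m_closed in \<open>simp_all add: tg hom_mult hom_in_carrier\<close>)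
  show "tensor_map S M N ra la f (pure m n) = pure (f m) n" if "m \<in> carrier M" "n \<in> carrier N"
    using that tg[OF pure_closed[OF that]] gx[OF frag_of_closed_free[OF that]] by (simp add: pure_eq)
qed

lemma tensor_map_extensional: "tensor_map S M N ra la f \<in> extensional (carrier tensor)"
  by (simp add: tensor_map_def)

end

section \<open>Finite sums and linear representations\<close>

lemma (in comm_monoid) finprod_swap:
  assumes "finite A" "finite B" "\<And>i j. \<lbrakk>i \<in> A; j \<in> B\<rbrakk> \<Longrightarrow> f i j \<in> carrier G"
  shows "(\<Otimes>i\<in>A. \<Otimes>j\<in>B. f i j) = (\<Otimes>j\<in>B. \<Otimes>i\<in>A. f i j)"
  using assms(1,3)
proof (induction A rule: finite_induct)
  case empty
  then show ?case by simp
next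
  case (insert a A)
  have "(\<Otimes>i\<in>insert a A. \<Otimes>j\<in>B. f i j) = (\<Otimes>j\<in>B. f a j) \<otimes> (\<Otimes>j\<in>B. \<Otimes>i\<in>A. f i j)"
    using insert by (subst finprod_insert) (auto simp: Pi_def)
  also have "\<dots> = (\<Otimes>j\<in>B. f a j \<otimes> (\<Otimes>i\<in>A. f i j))"
    using insert.prems by (subst finprod_multf) (auto simp: Pi_def)
  also have "\<dots> = (\<Otimes>j\<in>B. \<Otimes>i\<in>insert a A. f i j)"
    using insert by (intro finprod_cong') (auto simp: Pi_def)
  finally show ?case .
qed

lemma (in comm_monoid) hom_finprod:
  assumes "comm_monoid H" and h: "\<And>x y. \<lbrakk>x \<in> carrier G; y \<in> carrier G\<rbrakk> \<Longrightarrow> h (x \<otimes> y) = h x \<otimes>\<^bsub>H\<^esub> h y"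
    and "h \<one> = \<one>\<^bsub>H\<^esub>" and hc: "\<And>x. x \<in> carrier G \<Longrightarrow> h x \<in> carrier H"
    and f: "f \<in> A \<rightarrow> carrier G" and "finite A"
  shows "h (finprod G f A) = finprod H (\<lambda>i. h (f i)) A"
proof -
  interpret H: comm_monoid H by fact
  show ?thesis using \<open>finite A\<close> f
  proof (induction A rule: finite_induct)
    case empty
    then show ?case by (simp add: assms(3))
  next
    case (insert a A)
    then show ?case by (subst finprod_insert, simp_all, subst H.finprod_insert) (auto simp: Pi_def h hc)
  qed
qed

text \<open>Covers all additive maps met below: evaluation at a group element, the scalar action,
  \<open>tens\<close> in its first argument, \<open>coord\<close> and \<open>irep\<close>.\<close>

lemma (in abelian_monoid) additive_finsum:
  assumes "abelian_monoid H" and "\<And>x y. \<lbrakk>x \<in> carrier G; y \<in> carrier G\<rbrakk> \<Longrightarrow> h (x \<oplus> y) = h x \<oplus>\<^bsub>H\<^esub> h y"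
    and "h \<zero> = \<zero>\<^bsub>H\<^esub>" and "\<And>x. x \<in> carrier G \<Longrightarrow> h x \<in> carrier H"
    and "f \<in> A \<rightarrow> carrier G" and "finite A"
  shows "h (finsum G f A) = finsum H (\<lambda>i. h (f i)) A"
  using add.hom_finprod[of "add_monoid H" h f A] assms
  by (simp add: finsum_def abelian_monoid_def)

lemma (in module) finsum_smult_rdistr:
  assumes "finite A" "v \<in> carrier M" "f \<in> A \<rightarrow> carrier R"
  shows "(\<Oplus>\<^bsub>R\<^esub>i\<in>A. f i) \<odot>\<^bsub>M\<^esub> v = (\<Oplus>\<^bsub>M\<^esub>i\<in>A. f i \<odot>\<^bsub>M\<^esub> v)"
  using assms
  by (intro R.additive_finsum[where h = "\<lambda>c. c \<odot>\<^bsub>M\<^esub> v"]) (auto simp: smult_l_distr M.abelian_monoid_axioms)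

lemma linear_mapsD:
  assumes "f \<in> linear_maps F V W"
  shows linear_maps_closed: "v \<in> carrier V \<Longrightarrow> f v \<in> carrier W"
    and linear_maps_add: "\<lbrakk>v \<in> carrier V; w \<in> carrier V\<rbrakk> \<Longrightarrow> f (v \<oplus>\<^bsub>V\<^esub> w) = f v \<oplus>\<^bsub>W\<^esub> f w"
    and linear_maps_smult: "\<lbrakk>a \<in> carrier F; v \<in> carrier V\<rbrakk> \<Longrightarrow> f (a \<odot>\<^bsub>V\<^esub> v) = a \<odot>\<^bsub>W\<^esub> f v"
  using assms by (auto simp: linear_maps_def Pi_def)

section \<open>The general linear group and its representations\<close>

lemma one_GL: "\<one>\<^bsub>GL F V\<^esub> = (\<lambda>v\<in>carrier V. v)"
  by (simp add: GL_def BijGroup_def)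

lemma mult_GL:
  "\<lbrakk>f \<in> carrier (GL F V); g \<in> carrier (GL F V)\<rbrakk> \<Longrightarrow> f \<otimes>\<^bsub>GL F V\<^esub> g = compose (carrier V) f g"
  by (simp add: GL_def BijGroup_def)

lemma carrier_GL: "carrier (GL F V) = Bij (carrier V) \<inter> linear_maps F V V"
  by (simp add: GL_def)

lemma group_GL:
  assumes "module F V"
  shows "group (GL F V)"
proof -
  interpret V: module F V by fact
  interpret BG: group "BijGroup (carrier V)" by (rule group_BijGroup)
  have "subgroup (Bij (carrier V) \<inter> linear_maps F V V) (BijGroup (carrier V))"
  proof (rule BG.subgroupI)
    show "Bij (carrier V) \<inter> linear_maps F V V \<subseteq> carrier (BijGroup (carrier V))"
      by (auto simp: BijGroup_def)
    have "(\<lambda>v\<in>carrier V. v) \<in> Bij (carrier V) \<inter> linear_maps F V V"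
      by (auto simp: id_Bij linear_maps_def)
    then show "Bij (carrier V) \<inter> linear_maps F V V \<noteq> {}" by blast
  next
    fix f g assume f: "f \<in> Bij (carrier V) \<inter> linear_maps F V V" and g: "g \<in> Bij (carrier V) \<inter> linear_maps F V V"
    have "compose (carrier V) f g \<in> linear_maps F V V"
      using f g by (auto simp: linear_maps_def compose_def Pi_def)
    then show "f \<otimes>\<^bsub>BijGroup (carrier V)\<^esub> g \<in> Bij (carrier V) \<inter> linear_maps F V V"
      using f g by (auto simp: BijGroup_def compose_Bij)
  next
    fix f assume f: "f \<in> Bij (carrier V) \<inter> linear_maps F V V"
    let ?i = "inv_into (carrier V) f"
    have b: "bij_betw f (carrier V) (carrier V)" and l: "f \<in> linear_maps F V V"
      using f by (auto simp: Bij_def)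
    have ic: "?i v \<in> carrier V" if "v \<in> carrier V" for v
      using b that by (metis bij_betw_def inv_into_into)
    have fi: "f (?i v) = v" if "v \<in> carrier V" for v
      using b that by (simp add: bij_betw_inv_into_right)
    \<comment> \<open>Linearity of the inverse is proved by applying \<open>f\<close> to the
      expected value, which only uses linearity of \<open>f\<close>.\<close>
    have eq: "?i v = u" if "u \<in> carrier V" "f u = v" for u v
      using b that by (metis bij_betw_inv_into_left)
    have "(\<lambda>v\<in>carrier V. ?i v) \<in> linear_maps F V V"
      unfolding linear_maps_def
      by (auto intro!: eq simp: ic fi linear_maps_add[OF l] linear_maps_smult[OF l])
    then show "inv\<^bsub>BijGroup (carrier V)\<^esub> f \<in> Bij (carrier V) \<inter> linear_maps F V V"
      using f by (auto simp: inv_BijGroup restrict_inv_into_Bij)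
  qed
  then show ?thesis
    unfolding GL_def by (rule BG.subgroup_imp_group)
qed

lemma group_repD:
  assumes "group_rep F G V \<rho>" "group G"
  shows group_rep_linear: "g \<in> carrier G \<Longrightarrow> \<rho> g \<in> linear_maps F V V"
    and group_rep_mult: "\<lbrakk>g \<in> carrier G; h \<in> carrier G; v \<in> carrier V\<rbrakk> \<Longrightarrow> \<rho> (g \<otimes>\<^bsub>G\<^esub> h) v = \<rho> g (\<rho> h v)"
    and group_rep_one: "v \<in> carrier V \<Longrightarrow> \<rho> \<one>\<^bsub>G\<^esub> v = v"
proof -
  have r: "\<rho> \<in> hom G (GL F V)" and m: "module F V" using assms by (auto simp: group_rep_def)
  have c: "\<rho> g \<in> carrier (GL F V)" if "g \<in> carrier G" for g using hom_in_carrier[OF r that] .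
  then show "g \<in> carrier G \<Longrightarrow> \<rho> g \<in> linear_maps F V V"
    by (auto simp: carrier_GL)
  show "\<lbrakk>g \<in> carrier G; h \<in> carrier G; v \<in> carrier V\<rbrakk> \<Longrightarrow> \<rho> (g \<otimes>\<^bsub>G\<^esub> h) v = \<rho> g (\<rho> h v)"
    by (simp add: hom_mult[OF r] mult_GL c compose_eq)
  show "v \<in> carrier V \<Longrightarrow> \<rho> \<one>\<^bsub>G\<^esub> v = v"
    using hom_one[OF r assms(2) group_GL[OF m]] by (simp add: one_GL)
qed

text \<open>Bijectivity is automatic, as \<rho>(g^-1) inverts \<rho>(g). Extensionality is a
  hypothesis because elements of \<open>GL\<close> are functions fixed to be undefined outside the
  carrier.\<close>

lemma group_repI:
  assumes "field F" "module F V" "group G"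
    and lin: "\<And>g. g \<in> carrier G \<Longrightarrow> \<rho> g \<in> linear_maps F V V"
    and ext: "\<And>g. g \<in> carrier G \<Longrightarrow> \<rho> g \<in> extensional (carrier V)"
    and m: "\<And>g h v. \<lbrakk>g \<in> carrier G; h \<in> carrier G; v \<in> carrier V\<rbrakk> \<Longrightarrow> \<rho> (g \<otimes>\<^bsub>G\<^esub> h) v = \<rho> g (\<rho> h v)"
    and one: "\<And>v. v \<in> carrier V \<Longrightarrow> \<rho> \<one>\<^bsub>G\<^esub> v = v"
  shows "group_rep F G V \<rho>"
proof -
  interpret G: group G by fact
  have b: "\<rho> g \<in> carrier (GL F V)" if g: "g \<in> carrier G" for g
  proof -
    have "bij_betw (\<rho> g) (carrier V) (carrier V)"
      by (rule bij_betwI[where g = "\<rho> (inv\<^bsub>G\<^esub> g)"])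
        (use g in \<open>auto simp: m[symmetric] one intro: linear_maps_closed[OF lin]\<close>)
    then show ?thesis by (simp add: carrier_GL Bij_def lin ext g)
  qed
  have "\<rho> \<in> hom G (GL F V)"
  proof (rule homI)
    fix g h assume g: "g \<in> carrier G" and h: "h \<in> carrier G"
    show "\<rho> (g \<otimes>\<^bsub>G\<^esub> h) = \<rho> g \<otimes>\<^bsub>GL F V\<^esub> \<rho> h"
      unfolding mult_GL[OF b[OF g] b[OF h]]
      by (rule extensionalityI[of _ "carrier V"]) (use g h in \<open>auto simp: ext m compose_eq\<close>)
  qed (rule b)
  then show ?thesis by (simp add: group_rep_def assms)
qed

section \<open>Group algebras and induced modules\<close>

locale finite_group_algebra = F: field F + G: group G for F :: "'f ring" and G :: "'g monoid" +
  assumes finite_G: "finite (carrier G)"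
begin

abbreviation "FG \<equiv> group_algebra F G"

lemma carrier_FG: "carrier FG = carrier G \<rightarrow>\<^sub>E carrier F"
  by (simp add: group_algebra_def)

lemma FG_closed: "\<lbrakk>\<omega> \<in> carrier FG; x \<in> carrier G\<rbrakk> \<Longrightarrow> \<omega> x \<in> carrier F"
  by (auto simp: carrier_FG)

lemma FG_eqI:
  assumes "a \<in> carrier FG" "b \<in> carrier FG" "\<And>x. x \<in> carrier G \<Longrightarrow> a x = b x"
  shows "a = b"
  using assms by (auto simp: carrier_FG intro: PiE_ext)

lemma FG_add: "x \<in> carrier G \<Longrightarrow> (a \<oplus>\<^bsub>FG\<^esub> b) x = a x \<oplus>\<^bsub>F\<^esub> b x"
  by (simp add: group_algebra_def)

lemma FG_zero: "x \<in> carrier G \<Longrightarrow> \<zero>\<^bsub>FG\<^esub> x = \<zero>\<^bsub>F\<^esub>"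
  by (simp add: group_algebra_def)

lemma FG_add_closed: "\<lbrakk>a \<in> carrier FG; b \<in> carrier FG\<rbrakk> \<Longrightarrow> a \<oplus>\<^bsub>FG\<^esub> b \<in> carrier FG"
  by (auto simp: group_algebra_def)

lemma FG_zero_closed: "\<zero>\<^bsub>FG\<^esub> \<in> carrier FG"
  by (auto simp: group_algebra_def)

lemma abelian_group_FG: "abelian_group FG"
proof (rule abelian_groupI)
  fix a assume a: "a \<in> carrier FG"
  have m: "(\<lambda>x\<in>carrier G. \<ominus>\<^bsub>F\<^esub> a x) \<in> carrier FG"
    using a by (auto simp: carrier_FG)
  show "\<exists>b\<in>carrier FG. b \<oplus>\<^bsub>FG\<^esub> a = \<zero>\<^bsub>FG\<^esub>"
    by (rule bexI[OF _ m], rule FG_eqI)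
      (use a m in \<open>auto simp: FG_add FG_zero FG_zero_closed FG_add_closed FG_closed F.l_neg\<close>)
qed (auto intro!: FG_eqI simp: FG_add FG_zero FG_zero_closed FG_add_closed FG_closed F.a_ac)

lemma basis_closed: "group_algebra_basis F G g \<in> carrier FG"
  by (auto simp: group_algebra_basis_def carrier_FG)

lemma basis_apply:
  "x \<in> carrier G \<Longrightarrow> group_algebra_basis F G g x = (if x = g then \<one>\<^bsub>F\<^esub> else \<zero>\<^bsub>F\<^esub>)"
  by (simp add: group_algebra_basis_def)

lemma scale_closed: "\<lbrakk>c \<in> carrier F; \<omega> \<in> carrier FG\<rbrakk> \<Longrightarrow> group_algebra_scale F G c \<omega> \<in> carrier FG"
  by (auto simp: group_algebra_scale_def carrier_FG)

lemma scale_apply: "x \<in> carrier G \<Longrightarrow> group_algebra_scale F G c \<omega> x = c \<otimes>\<^bsub>F\<^esub> \<omega> x"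
  by (simp add: group_algebra_scale_def)

abbreviation "shift g \<omega> \<equiv> group_algebra_basis F G g \<otimes>\<^bsub>FG\<^esub> \<omega>"

lemma mult_FG_apply:
  "x \<in> carrier G \<Longrightarrow> (a \<otimes>\<^bsub>FG\<^esub> b) x = (\<Oplus>\<^bsub>F\<^esub>y\<in>carrier G. a y \<otimes>\<^bsub>F\<^esub> b (inv\<^bsub>G\<^esub> y \<otimes>\<^bsub>G\<^esub> x))"
  by (simp add: group_algebra_def)

lemma mult_FG_closed: "\<lbrakk>a \<in> carrier FG; b \<in> carrier FG\<rbrakk> \<Longrightarrow> a \<otimes>\<^bsub>FG\<^esub> b \<in> carrier FG"
  by (auto simp: group_algebra_def intro!: F.finsum_closed)

text \<open>Only the term y = g of the convolution survives. From here on left multiplication by a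
  group element is a translation of functions, and the remaining laws for \<open>shift\<close> are
  pointwise.\<close>

lemma shift_apply:
  assumes g: "g \<in> carrier G" and w: "\<omega> \<in> carrier FG" and x: "x \<in> carrier G"
  shows "shift g \<omega> x = \<omega> (inv\<^bsub>G\<^esub> g \<otimes>\<^bsub>G\<^esub> x)"
proof -
  have "shift g \<omega> x = (\<Oplus>\<^bsub>F\<^esub>y\<in>carrier G. if g = y then \<omega> (inv\<^bsub>G\<^esub> y \<otimes>\<^bsub>G\<^esub> x) else \<zero>\<^bsub>F\<^esub>)"
    unfolding mult_FG_apply[OF x]
    by (rule F.finsum_cong') (use g w x in \<open>auto simp: basis_apply FG_closed\<close>)
  also have "\<dots> = \<omega> (inv\<^bsub>G\<^esub> g \<otimes>\<^bsub>G\<^esub> x)"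
    by (rule F.finsum_singleton) (use g w x in \<open>auto simp: FG_closed finite_G\<close>)
  finally show ?thesis .
qed

lemma shift_closed: "\<omega> \<in> carrier FG \<Longrightarrow> shift g \<omega> \<in> carrier FG"
  by (rule mult_FG_closed[OF basis_closed])

lemma shift_mult:
  assumes "g \<in> carrier G" "h \<in> carrier G" "\<omega> \<in> carrier FG"
  shows "shift (g \<otimes>\<^bsub>G\<^esub> h) \<omega> = shift g (shift h \<omega>)"
  by (rule FG_eqI) (use assms in \<open>auto simp: shift_closed shift_apply G.inv_mult_group G.m_assoc\<close>)

lemma shift_one: "\<omega> \<in> carrier FG \<Longrightarrow> shift \<one>\<^bsub>G\<^esub> \<omega> = \<omega>"
  by (rule FG_eqI) (auto simp: shift_closed shift_apply)

lemma shift_add: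
  assumes "g \<in> carrier G" "\<omega> \<in> carrier FG" "\<omega>' \<in> carrier FG"
  shows "shift g (\<omega> \<oplus>\<^bsub>FG\<^esub> \<omega>') = shift g \<omega> \<oplus>\<^bsub>FG\<^esub> shift g \<omega>'"
  by (rule FG_eqI) (use assms in \<open>auto simp: shift_closed shift_apply FG_add FG_add_closed\<close>)

lemma shift_scale:
  assumes "g \<in> carrier G" "c \<in> carrier F" "\<omega> \<in> carrier FG"
  shows "shift g (group_algebra_scale F G c \<omega>) = group_algebra_scale F G c (shift g \<omega>)"
  by (rule FG_eqI) (use assms in \<open>auto simp: shift_closed shift_apply scale_closed scale_apply\<close>)

lemma shift_basis:
  assumes "g \<in> carrier G" "h \<in> carrier G"
  shows "shift g (group_algebra_basis F G h) = group_algebra_basis F G (g \<otimes>\<^bsub>G\<^esub> h)"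
proof (rule FG_eqI)
  fix x assume x: "x \<in> carrier G"
  have "inv\<^bsub>G\<^esub> g \<otimes>\<^bsub>G\<^esub> x = h \<longleftrightarrow> x = g \<otimes>\<^bsub>G\<^esub> h"
    using assms x by (metis G.inv_solve_left)
  then show "shift g (group_algebra_basis F G h) x = group_algebra_basis F G (g \<otimes>\<^bsub>G\<^esub> h) x"
    using assms x by (simp add: shift_apply basis_closed basis_apply)
qed (auto intro: shift_closed basis_closed)

lemma finsum_FG_apply:
  assumes "finite A" "f \<in> A \<rightarrow> carrier FG" "x \<in> carrier G"
  shows "(\<Oplus>\<^bsub>FG\<^esub>i\<in>A. f i) x = (\<Oplus>\<^bsub>F\<^esub>i\<in>A. f i x)"
proof -
  interpret FG: abelian_group FG by (rule abelian_group_FG)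
  show ?thesis
    by (rule FG.additive_finsum[where h = "\<lambda>a. a x"])
      (use assms in \<open>auto simp: FG_add FG_zero FG_closed F.abelian_monoid_axioms\<close>)
qed

end

section \<open>The right action of FL on FG and the left action of FL on V\<close>

locale induced = finite_group_algebra F G + V: module F V
  for F :: "'f ring" and G :: "'g monoid" and L :: "'g set" and V :: "('f, 'v) module"
    and \<sigma> :: "'g \<Rightarrow> 'v \<Rightarrow> 'v" +
  assumes subgroup_L: "subgroup L G"
    and rep_L: "group_rep F (G\<lparr>carrier := L\<rparr>) V \<sigma>"
begin

interpretation L: subgroup L G by (rule subgroup_L)

abbreviation "FL \<equiv> group_algebra F (G\<lparr>carrier := L\<rparr>)"
abbreviation "ract \<equiv> group_algebra_ract F G L"
abbreviation "lact \<equiv> group_algebra_lact V L \<sigma>"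

lemma group_L: "group (G\<lparr>carrier := L\<rparr>)"
  by (rule G.subgroup_imp_group[OF subgroup_L])

lemma L_in_G: "l \<in> L \<Longrightarrow> l \<in> carrier G"
  by (rule L.mem_carrier)

lemma L_mult: "\<lbrakk>l \<in> L; m \<in> L\<rbrakk> \<Longrightarrow> l \<otimes>\<^bsub>G\<^esub> m \<in> L"
  by (rule L.m_closed)

lemma L_inv: "l \<in> L \<Longrightarrow> inv\<^bsub>G\<^esub> l \<in> L"
  by (rule L.m_inv_closed)

lemma finite_L: "finite L"
  using finite_subset[OF L.subset finite_G] .

lemma \<sigma>_linear: "l \<in> L \<Longrightarrow> \<sigma> l \<in> linear_maps F V V"
  using group_rep_linear[OF rep_L group_L] by simp

lemma \<sigma>_closed: "\<lbrakk>l \<in> L; v \<in> carrier V\<rbrakk> \<Longrightarrow> \<sigma> l v \<in> carrier V"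
  by (rule linear_maps_closed[OF \<sigma>_linear])

lemma \<sigma>_mult: "\<lbrakk>l \<in> L; m \<in> L; v \<in> carrier V\<rbrakk> \<Longrightarrow> \<sigma> (l \<otimes>\<^bsub>G\<^esub> m) v = \<sigma> l (\<sigma> m v)"
  using group_rep_mult[OF rep_L group_L] by simp

lemma \<sigma>_one: "v \<in> carrier V \<Longrightarrow> \<sigma> \<one>\<^bsub>G\<^esub> v = v"
  using group_rep_one[OF rep_L group_L] by simp

lemma \<sigma>_zero: "l \<in> L \<Longrightarrow> \<sigma> l \<zero>\<^bsub>V\<^esub> = \<zero>\<^bsub>V\<^esub>"
  using linear_maps_smult[OF \<sigma>_linear, of l "\<zero>\<^bsub>F\<^esub>" "\<zero>\<^bsub>V\<^esub>"] \<sigma>_closed[of l "\<zero>\<^bsub>V\<^esub>"] by simp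

lemma carrier_FL: "carrier FL = L \<rightarrow>\<^sub>E carrier F"
  by (simp add: group_algebra_def)

lemma FL_closed: "\<lbrakk>s \<in> carrier FL; x \<in> L\<rbrakk> \<Longrightarrow> s x \<in> carrier F"
  by (auto simp: carrier_FL)

lemma incl_closed: "s \<in> carrier FL \<Longrightarrow> group_algebra_incl F G L s \<in> carrier FG"
  by (auto simp: carrier_FG carrier_FL group_algebra_incl_def)

lemma ract_closed: "\<lbrakk>\<omega> \<in> carrier FG; s \<in> carrier FL\<rbrakk> \<Longrightarrow> ract \<omega> s \<in> carrier FG"
  unfolding group_algebra_ract_def by (intro mult_FG_closed incl_closed)

text \<open>In the convolution over G the factor from \<open>group_algebra_incl\<close> vanishes
  unless y^-1 x lies in L. The substitution y = x m^-1 leaves a sum over L in which the inclusion no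
  longer occurs.\<close>

lemma ract_apply:
  assumes w: "\<omega> \<in> carrier FG" and s: "s \<in> carrier FL" and x: "x \<in> carrier G"
  shows "ract \<omega> s x = (\<Oplus>\<^bsub>F\<^esub>m\<in>L. \<omega> (x \<otimes>\<^bsub>G\<^esub> inv\<^bsub>G\<^esub> m) \<otimes>\<^bsub>F\<^esub> s m)"
proof -
  let ?i = "group_algebra_incl F G L s" and ?h = "\<lambda>m. x \<otimes>\<^bsub>G\<^esub> inv\<^bsub>G\<^esub> m"
  let ?f = "\<lambda>y. \<omega> y \<otimes>\<^bsub>F\<^esub> ?i (inv\<^bsub>G\<^esub> y \<otimes>\<^bsub>G\<^esub> x)"
  have fc: "?f \<in> carrier G \<rightarrow> carrier F"
    using w incl_closed[OF s] x by (auto simp: FG_closed)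
  have sub: "?h ` L \<subseteq> carrier G" using x L_in_G by auto
  have hm: "inv\<^bsub>G\<^esub> (?h m) \<otimes>\<^bsub>G\<^esub> x = m" if "m \<in> L" for m
    using that x by (simp add: L_in_G G.inv_mult_group G.m_assoc)
  have "ract \<omega> s x = finsum F ?f (carrier G)"
    by (simp add: group_algebra_ract_def mult_FG_apply[OF x])
  also have "\<dots> = finsum F ?f (?h ` L)"
  proof (rule F.add.finprod_mono_neutral_cong_right[OF finite_G sub])
    fix y assume y: "y \<in> carrier G - ?h ` L"
    have "inv\<^bsub>G\<^esub> y \<otimes>\<^bsub>G\<^esub> x \<notin> L"
    proof
      assume "inv\<^bsub>G\<^esub> y \<otimes>\<^bsub>G\<^esub> x \<in> L"
      moreover have "y = ?h (inv\<^bsub>G\<^esub> y \<otimes>\<^bsub>G\<^esub> x)"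
        using x y by (simp add: G.inv_mult_group G.m_assoc[symmetric])
      ultimately show False using y by blast
    qed
    then show "?f y = \<zero>\<^bsub>F\<^esub>"
      using x y w by (simp add: group_algebra_incl_def FG_closed)
  qed (use fc in auto)
  also have "\<dots> = (\<Oplus>\<^bsub>F\<^esub>m\<in>L. ?f (?h m))"
    using fc sub hm by (intro F.finsum_reindex) (auto intro!: inj_onI, metis)
  also have "\<dots> = (\<Oplus>\<^bsub>F\<^esub>m\<in>L. \<omega> (?h m) \<otimes>\<^bsub>F\<^esub> s m)"
    by (rule F.finsum_cong') (use w s x in \<open>auto simp: hm group_algebra_incl_def L_in_G FG_closed FL_closed\<close>)
  finally show ?thesis .
qed

text \<open>Left and right multiplication commute. This and \<open>scale_ract\<close> are the
  compatibility conditions under which group elements and scalars act on the tensor product through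
  FG.\<close>

lemma shift_ract:
  assumes "g \<in> carrier G" "\<omega> \<in> carrier FG" "s \<in> carrier FL"
  shows "shift g (ract \<omega> s) = ract (shift g \<omega>) s"
  by (rule FG_eqI)
    (use assms in \<open>auto simp: shift_closed ract_closed shift_apply ract_apply L_in_G FG_closed FL_closed
       G.m_assoc intro!: F.finsum_cong'\<close>)

lemma scale_ract:
  assumes "c \<in> carrier F" "\<omega> \<in> carrier FG" "s \<in> carrier FL"
  shows "group_algebra_scale F G c (ract \<omega> s) = ract (group_algebra_scale F G c \<omega>) s"
proof (rule FG_eqI)
  fix x assume x: "x \<in> carrier G"
  have "c \<otimes>\<^bsub>F\<^esub> (\<Oplus>\<^bsub>F\<^esub>m\<in>L. \<omega> (x \<otimes>\<^bsub>G\<^esub> inv\<^bsub>G\<^esub> m) \<otimes>\<^bsub>F\<^esub> s m) =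
      (\<Oplus>\<^bsub>F\<^esub>m\<in>L. c \<otimes>\<^bsub>F\<^esub> (\<omega> (x \<otimes>\<^bsub>G\<^esub> inv\<^bsub>G\<^esub> m) \<otimes>\<^bsub>F\<^esub> s m))"
    by (rule F.finsum_rdistr) (use assms x finite_L in \<open>auto simp: L_in_G FG_closed FL_closed\<close>)
  also have "\<dots> = (\<Oplus>\<^bsub>F\<^esub>m\<in>L. group_algebra_scale F G c \<omega> (x \<otimes>\<^bsub>G\<^esub> inv\<^bsub>G\<^esub> m) \<otimes>\<^bsub>F\<^esub> s m)"
    by (rule F.finsum_cong') (use assms x in \<open>auto simp: L_in_G FG_closed FL_closed scale_apply F.m_assoc\<close>)
  finally show "group_algebra_scale F G c (ract \<omega> s) x = ract (group_algebra_scale F G c \<omega>) s x"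
    using assms x by (simp add: scale_apply ract_apply scale_closed)
qed (use assms in \<open>auto simp: scale_closed ract_closed\<close>)

lemma lact_closed: "\<lbrakk>s \<in> carrier FL; v \<in> carrier V\<rbrakk> \<Longrightarrow> lact s v \<in> carrier V"
  unfolding group_algebra_lact_def by (rule V.M.finsum_closed) (auto simp: FL_closed \<sigma>_closed)

sublocale T: balanced_tensor FL FG V ract lact
  by (intro balanced_tensor.intro abelian_group_FG V.abelian_group_axioms
      balanced_tensor_axioms.intro ract_closed lact_closed)

lemma lact_add_right:
  assumes "s \<in> carrier FL" "v \<in> carrier V" "w \<in> carrier V"
  shows "lact s (v \<oplus>\<^bsub>V\<^esub> w) = lact s v \<oplus>\<^bsub>V\<^esub> lact s w"
proof -
  have "lact s (v \<oplus>\<^bsub>V\<^esub> w) = (\<Oplus>\<^bsub>V\<^esub>l\<in>L. s l \<odot>\<^bsub>V\<^esub> \<sigma> l v \<oplus>\<^bsub>V\<^esub> s l \<odot>\<^bsub>V\<^esub> \<sigma> l w)"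
    unfolding group_algebra_lact_def
    by (rule V.M.finsum_cong')
      (use assms in \<open>auto simp: FL_closed \<sigma>_closed linear_maps_add[OF \<sigma>_linear] V.smult_r_distr\<close>)
  also have "\<dots> = lact s v \<oplus>\<^bsub>V\<^esub> lact s w"
    unfolding group_algebra_lact_def
    by (rule V.M.finsum_addf) (use assms in \<open>auto simp: FL_closed \<sigma>_closed\<close>)
  finally show ?thesis .
qed

lemma lact_add_left:
  assumes "s \<in> carrier FL" "s' \<in> carrier FL" "v \<in> carrier V" "u \<in> carrier FL"
    and "\<And>l. l \<in> L \<Longrightarrow> u l = s l \<oplus>\<^bsub>F\<^esub> s' l"
  shows "lact u v = lact s v \<oplus>\<^bsub>V\<^esub> lact s' v"
proof -
  have "lact u v = (\<Oplus>\<^bsub>V\<^esub>l\<in>L. s l \<odot>\<^bsub>V\<^esub> \<sigma> l v \<oplus>\<^bsub>V\<^esub> s' l \<odot>\<^bsub>V\<^esub> \<sigma> l v)"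
    unfolding group_algebra_lact_def
    by (rule V.M.finsum_cong') (use assms in \<open>auto simp: FL_closed \<sigma>_closed V.smult_l_distr\<close>)
  also have "\<dots> = lact s v \<oplus>\<^bsub>V\<^esub> lact s' v"
    unfolding group_algebra_lact_def
    by (rule V.M.finsum_addf) (use assms in \<open>auto simp: FL_closed \<sigma>_closed\<close>)
  finally show ?thesis .
qed

text \<open>The function is the element c l of FL. Taking c = 1 gives the action of a group element
  and l = 1 that of a scalar; \<open>tens_basis_mult\<close> needs both.\<close>

lemma lact_single:
  assumes "l \<in> L" "c \<in> carrier F" "v \<in> carrier V"
  shows "lact (\<lambda>x\<in>L. if x = l then c else \<zero>\<^bsub>F\<^esub>) v = c \<odot>\<^bsub>V\<^esub> \<sigma> l v"
proof -
  have "lact (\<lambda>x\<in>L. if x = l then c else \<zero>\<^bsub>F\<^esub>) v =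
      (\<Oplus>\<^bsub>V\<^esub>x\<in>L. if l = x then c \<odot>\<^bsub>V\<^esub> \<sigma> x v else \<zero>\<^bsub>V\<^esub>)"
    unfolding group_algebra_lact_def
    by (rule V.M.finsum_cong') (use assms in \<open>auto simp: \<sigma>_closed\<close>)
  also have "\<dots> = c \<odot>\<^bsub>V\<^esub> \<sigma> l v"
    by (rule V.M.finsum_singleton) (use assms finite_L in \<open>auto simp: \<sigma>_closed\<close>)
  finally show ?thesis .
qed

text \<open>Right multiplication by FL only mixes values of \<omega> within one left coset of L, so
  the piece of \<omega> on gL can be treated by itself, as an element of FL.\<close>

definition restr :: "'g \<Rightarrow> ('g \<Rightarrow> 'f) \<Rightarrow> 'g \<Rightarrow> 'f" where
  "restr g \<omega> = (\<lambda>l\<in>L. \<omega> (g \<otimes>\<^bsub>G\<^esub> l))"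

lemma restr_closed: "\<lbrakk>g \<in> carrier G; \<omega> \<in> carrier FG\<rbrakk> \<Longrightarrow> restr g \<omega> \<in> carrier FL"
  by (auto simp: restr_def carrier_FL L_in_G FG_closed)

lemma restr_apply: "l \<in> L \<Longrightarrow> restr g \<omega> l = \<omega> (g \<otimes>\<^bsub>G\<^esub> l)"
  by (simp add: restr_def)

text \<open>This is the associativity \<open>(ab) v = a (b v)\<close> of the \<open>FL\<close>-module \<open>V\<close>, where \<open>a\<close> is the
  restriction of \<open>\<omega>\<close> to the coset \<open>gL\<close>.\<close>

lemma lact_restr_ract:
  assumes g: "g \<in> carrier G" and w: "\<omega> \<in> carrier FG" and s: "s \<in> carrier FL" and v: "v \<in> carrier V"
  shows "lact (restr g (ract \<omega> s)) v = lact (restr g \<omega>) (lact s v)"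
proof -
  note [simp] = g w s v L_in_G L_mult L_inv FG_closed FL_closed \<sigma>_closed
  have "lact (restr g (ract \<omega> s)) v =
     (\<Oplus>\<^bsub>V\<^esub>l\<in>L. \<Oplus>\<^bsub>V\<^esub>m\<in>L. (\<omega> (g \<otimes>\<^bsub>G\<^esub> l \<otimes>\<^bsub>G\<^esub> inv\<^bsub>G\<^esub> m) \<otimes>\<^bsub>F\<^esub> s m) \<odot>\<^bsub>V\<^esub> \<sigma> l v)"
    unfolding group_algebra_lact_def
    by (rule V.M.finsum_cong')
      (auto simp: restr_apply ract_apply finite_L intro!: V.finsum_smult_rdistr V.M.finsum_closed)
  \<comment> \<open>With \<open>m\<close> as the outer variable, l = n m can be substituted for
    fixed \<open>m\<close>, since right translation by \<open>m\<close> permutes L. The second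
    exchange makes \<open>n\<close> outer again, so that \<sigma>(n) can be pulled out of the inner
    sum.\<close>
  also have "\<dots> = (\<Oplus>\<^bsub>V\<^esub>m\<in>L. \<Oplus>\<^bsub>V\<^esub>l\<in>L. (\<omega> (g \<otimes>\<^bsub>G\<^esub> l \<otimes>\<^bsub>G\<^esub> inv\<^bsub>G\<^esub> m) \<otimes>\<^bsub>F\<^esub> s m) \<odot>\<^bsub>V\<^esub> \<sigma> l v)"
    unfolding finsum_def
    by (rule comm_monoid.finprod_swap[OF V.M.a_comm_monoid]) (auto simp: finite_L)
  also have "\<dots> = (\<Oplus>\<^bsub>V\<^esub>m\<in>L. \<Oplus>\<^bsub>V\<^esub>n\<in>L. (\<omega> (g \<otimes>\<^bsub>G\<^esub> n) \<otimes>\<^bsub>F\<^esub> s m) \<odot>\<^bsub>V\<^esub> \<sigma> (n \<otimes>\<^bsub>G\<^esub> m) v)"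
  proof (rule V.M.finsum_cong'[OF refl])
    fix m assume m: "m \<in> L"
    have "(\<lambda>n. n \<otimes>\<^bsub>G\<^esub> m) ` L = L"
    proof (intro equalityI subsetI)
      fix l assume "l \<in> L"
      then have "l = (l \<otimes>\<^bsub>G\<^esub> inv\<^bsub>G\<^esub> m) \<otimes>\<^bsub>G\<^esub> m" "l \<otimes>\<^bsub>G\<^esub> inv\<^bsub>G\<^esub> m \<in> L"
        using m by (auto simp: G.m_assoc)
      then show "l \<in> (\<lambda>n. n \<otimes>\<^bsub>G\<^esub> m) ` L" by blast
    qed (use m in auto)
    moreover have "inj_on (\<lambda>n. n \<otimes>\<^bsub>G\<^esub> m) L"
      using m by (auto intro!: inj_onI)
    moreover have "(\<lambda>l. (\<omega> (g \<otimes>\<^bsub>G\<^esub> l \<otimes>\<^bsub>G\<^esub> inv\<^bsub>G\<^esub> m) \<otimes>\<^bsub>F\<^esub> s m) \<odot>\<^bsub>V\<^esub> \<sigma> l v) \<in> L \<rightarrow> carrier V"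
      using m by auto
    ultimately have "(\<Oplus>\<^bsub>V\<^esub>l\<in>L. (\<omega> (g \<otimes>\<^bsub>G\<^esub> l \<otimes>\<^bsub>G\<^esub> inv\<^bsub>G\<^esub> m) \<otimes>\<^bsub>F\<^esub> s m) \<odot>\<^bsub>V\<^esub> \<sigma> l v) =
       (\<Oplus>\<^bsub>V\<^esub>n\<in>L. (\<omega> (g \<otimes>\<^bsub>G\<^esub> (n \<otimes>\<^bsub>G\<^esub> m) \<otimes>\<^bsub>G\<^esub> inv\<^bsub>G\<^esub> m) \<otimes>\<^bsub>F\<^esub> s m) \<odot>\<^bsub>V\<^esub> \<sigma> (n \<otimes>\<^bsub>G\<^esub> m) v)"
      using V.M.finsum_reindex[of "\<lambda>l. (\<omega> (g \<otimes>\<^bsub>G\<^esub> l \<otimes>\<^bsub>G\<^esub> inv\<^bsub>G\<^esub> m) \<otimes>\<^bsub>F\<^esub> s m) \<odot>\<^bsub>V\<^esub> \<sigma> l v" "\<lambda>n. n \<otimes>\<^bsub>G\<^esub> m" L]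
      by simp
    also have "\<dots> = (\<Oplus>\<^bsub>V\<^esub>n\<in>L. (\<omega> (g \<otimes>\<^bsub>G\<^esub> n) \<otimes>\<^bsub>F\<^esub> s m) \<odot>\<^bsub>V\<^esub> \<sigma> (n \<otimes>\<^bsub>G\<^esub> m) v)"
      by (rule V.M.finsum_cong') (use m in \<open>auto simp: G.m_assoc\<close>)
    finally show "(\<Oplus>\<^bsub>V\<^esub>l\<in>L. (\<omega> (g \<otimes>\<^bsub>G\<^esub> l \<otimes>\<^bsub>G\<^esub> inv\<^bsub>G\<^esub> m) \<otimes>\<^bsub>F\<^esub> s m) \<odot>\<^bsub>V\<^esub> \<sigma> l v) = \<dots>" .
  qed (auto intro!: V.M.finsum_closed)
  also have "\<dots> = (\<Oplus>\<^bsub>V\<^esub>n\<in>L. \<Oplus>\<^bsub>V\<^esub>m\<in>L. (\<omega> (g \<otimes>\<^bsub>G\<^esub> n) \<otimes>\<^bsub>F\<^esub> s m) \<odot>\<^bsub>V\<^esub> \<sigma> (n \<otimes>\<^bsub>G\<^esub> m) v)"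
    unfolding finsum_def
    by (rule comm_monoid.finprod_swap[OF V.M.a_comm_monoid]) (auto simp: finite_L)
  also have "\<dots> = (\<Oplus>\<^bsub>V\<^esub>n\<in>L. \<omega> (g \<otimes>\<^bsub>G\<^esub> n) \<odot>\<^bsub>V\<^esub> \<sigma> n (\<Oplus>\<^bsub>V\<^esub>m\<in>L. s m \<odot>\<^bsub>V\<^esub> \<sigma> m v))"
  proof (rule V.M.finsum_cong'[OF refl])
    fix n assume n: "n \<in> L"
    have "\<omega> (g \<otimes>\<^bsub>G\<^esub> n) \<odot>\<^bsub>V\<^esub> \<sigma> n (\<Oplus>\<^bsub>V\<^esub>m\<in>L. s m \<odot>\<^bsub>V\<^esub> \<sigma> m v) =
       (\<Oplus>\<^bsub>V\<^esub>m\<in>L. \<omega> (g \<otimes>\<^bsub>G\<^esub> n) \<odot>\<^bsub>V\<^esub> \<sigma> n (s m \<odot>\<^bsub>V\<^esub> \<sigma> m v))"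
      by (rule V.M.additive_finsum[where h = "\<lambda>u. \<omega> (g \<otimes>\<^bsub>G\<^esub> n) \<odot>\<^bsub>V\<^esub> \<sigma> n u"])
        (use n in \<open>auto simp: V.M.abelian_monoid_axioms linear_maps_add[OF \<sigma>_linear] \<sigma>_zero V.smult_r_distr finite_L\<close>)
    also have "\<dots> = (\<Oplus>\<^bsub>V\<^esub>m\<in>L. (\<omega> (g \<otimes>\<^bsub>G\<^esub> n) \<otimes>\<^bsub>F\<^esub> s m) \<odot>\<^bsub>V\<^esub> \<sigma> (n \<otimes>\<^bsub>G\<^esub> m) v)"
      by (rule V.M.finsum_cong')
        (use n in \<open>auto simp: \<sigma>_mult V.smult_assoc1 linear_maps_smult[OF \<sigma>_linear]\<close>)
    finally show "(\<Oplus>\<^bsub>V\<^esub>m\<in>L. (\<omega> (g \<otimes>\<^bsub>G\<^esub> n) \<otimes>\<^bsub>F\<^esub> s m) \<odot>\<^bsub>V\<^esub> \<sigma> (n \<otimes>\<^bsub>G\<^esub> m) v) =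
      \<omega> (g \<otimes>\<^bsub>G\<^esub> n) \<odot>\<^bsub>V\<^esub> \<sigma> n (\<Oplus>\<^bsub>V\<^esub>m\<in>L. s m \<odot>\<^bsub>V\<^esub> \<sigma> m v)" ..
  qed (auto intro!: V.M.finsum_closed)
  also have "\<dots> = lact (restr g \<omega>) (lact s v)"
    unfolding group_algebra_lact_def
    by (rule V.M.finsum_cong') (auto simp: restr_apply intro!: V.M.finsum_closed)
  finally show ?thesis .
qed

end

section \<open>The induced vector space W and the action of G on it\<close>

context induced
begin

interpretation T: comm_group T.tensor by (rule T.comm_group_tensor)

abbreviation "W \<equiv> ind_module F G L V \<sigma>"
abbreviation "tens \<equiv> ind_tensor F G L V \<sigma>"
abbreviation "basis \<equiv> group_algebra_basis F G"

lemma tens_eq: "tens = T.pure"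
  by (simp add: ind_tensor_def)

lemma carrier_W: "carrier W = carrier T.tensor"
  and add_W: "x \<oplus>\<^bsub>W\<^esub> y = x \<otimes>\<^bsub>T.tensor\<^esub> y"
  and zero_W: "\<zero>\<^bsub>W\<^esub> = \<one>\<^bsub>T.tensor\<^esub>"
  and smult_W: "c \<odot>\<^bsub>W\<^esub> w = ind_map F G L V \<sigma> (group_algebra_scale F G c) w"
  by (simp_all add: ind_module_def Let_def)

lemma abelian_group_W: "abelian_group W"
  by (rule abelian_groupI)
    (use T.l_inv T.inv_closed in \<open>auto simp: carrier_W add_W zero_W T.m_ac\<close>)

interpretation W: abelian_group W by (rule abelian_group_W)

lemma tens_closed: "\<lbrakk>\<omega> \<in> carrier FG; v \<in> carrier V\<rbrakk> \<Longrightarrow> tens \<omega> v \<in> carrier W"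
  by (simp add: tens_eq carrier_W T.pure_closed)

lemma tens_add_left:
  "\<lbrakk>\<omega> \<in> carrier FG; \<omega>' \<in> carrier FG; v \<in> carrier V\<rbrakk> \<Longrightarrow>
     tens (\<omega> \<oplus>\<^bsub>FG\<^esub> \<omega>') v = tens \<omega> v \<oplus>\<^bsub>W\<^esub> tens \<omega>' v"
  by (simp add: tens_eq add_W T.pure_add_left)

lemma tens_add_right:
  "\<lbrakk>\<omega> \<in> carrier FG; v \<in> carrier V; v' \<in> carrier V\<rbrakk> \<Longrightarrow>
     tens \<omega> (v \<oplus>\<^bsub>V\<^esub> v') = tens \<omega> v \<oplus>\<^bsub>W\<^esub> tens \<omega> v'"
  by (simp add: tens_eq add_W T.pure_add_right)

lemma tens_balanced:
  "\<lbrakk>\<omega> \<in> carrier FG; s \<in> carrier FL; v \<in> carrier V\<rbrakk> \<Longrightarrow> tens (ract \<omega> s) v = tens \<omega> (lact s v)"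
  by (simp add: tens_eq T.pure_balanced)

lemma tens_zero_left: "v \<in> carrier V \<Longrightarrow> tens \<zero>\<^bsub>FG\<^esub> v = \<zero>\<^bsub>W\<^esub>"
  by (simp add: tens_eq zero_W T.pure_zero_left)

lemma W_induct [consumes 1, case_names tens add]:
  assumes "w \<in> carrier W"
    and "\<And>\<omega> v. \<lbrakk>\<omega> \<in> carrier FG; v \<in> carrier V\<rbrakk> \<Longrightarrow> P (tens \<omega> v)"
    and "\<And>a b. \<lbrakk>a \<in> carrier W; b \<in> carrier W; P a; P b\<rbrakk> \<Longrightarrow> P (a \<oplus>\<^bsub>W\<^esub> b)"
  shows "P w"
  using T.tensor_induct[of w P] assms by (simp add: carrier_W add_W tens_eq)

text \<open>Transfers the properties of \<open>tensor_map\<close> to the module record. Both the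
  scalars, with \<open>group_algebra_scale\<close>, and the group, with \<open>shift\<close>, act on
  W in this way.\<close>

lemma ind_map:
  assumes "\<And>\<omega>. \<omega> \<in> carrier FG \<Longrightarrow> f \<omega> \<in> carrier FG"
    and "\<And>\<omega> \<omega>'. \<lbrakk>\<omega> \<in> carrier FG; \<omega>' \<in> carrier FG\<rbrakk> \<Longrightarrow> f (\<omega> \<oplus>\<^bsub>FG\<^esub> \<omega>') = f \<omega> \<oplus>\<^bsub>FG\<^esub> f \<omega>'"
    and "\<And>\<omega> s. \<lbrakk>\<omega> \<in> carrier FG; s \<in> carrier FL\<rbrakk> \<Longrightarrow> f (ract \<omega> s) = ract (f \<omega>) s"
  shows ind_map_tens: "\<lbrakk>\<omega> \<in> carrier FG; v \<in> carrier V\<rbrakk> \<Longrightarrow> ind_map F G L V \<sigma> f (tens \<omega> v) = tens (f \<omega>) v"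
    and ind_map_add: "\<lbrakk>a \<in> carrier W; b \<in> carrier W\<rbrakk> \<Longrightarrow>
      ind_map F G L V \<sigma> f (a \<oplus>\<^bsub>W\<^esub> b) = ind_map F G L V \<sigma> f a \<oplus>\<^bsub>W\<^esub> ind_map F G L V \<sigma> f b"
    and ind_map_closed: "a \<in> carrier W \<Longrightarrow> ind_map F G L V \<sigma> f a \<in> carrier W"
  using T.tensor_map_pure[of f, OF assms, simplified] hom_mult[OF T.tensor_map_hom[of f, OF assms, simplified]]
    hom_in_carrier[OF T.tensor_map_hom[of f, OF assms, simplified]]
  by (simp_all add: ind_map_def tens_eq carrier_W add_W)

lemma scale_add:
  "\<lbrakk>c \<in> carrier F; \<omega> \<in> carrier FG; \<omega>' \<in> carrier FG\<rbrakk> \<Longrightarrow> group_algebra_scale F G c (\<omega> \<oplus>\<^bsub>FG\<^esub> \<omega>') =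
     group_algebra_scale F G c \<omega> \<oplus>\<^bsub>FG\<^esub> group_algebra_scale F G c \<omega>'"
  by (rule FG_eqI) (auto simp: scale_closed scale_apply FG_add FG_add_closed FG_closed F.r_distr)

lemma smult_W_tens:
  "\<lbrakk>c \<in> carrier F; \<omega> \<in> carrier FG; v \<in> carrier V\<rbrakk> \<Longrightarrow> c \<odot>\<^bsub>W\<^esub> tens \<omega> v = tens (group_algebra_scale F G c \<omega>) v"
  unfolding smult_W by (rule ind_map_tens) (auto simp: scale_closed scale_add scale_ract)

lemma smult_W_add:
  "\<lbrakk>c \<in> carrier F; a \<in> carrier W; b \<in> carrier W\<rbrakk> \<Longrightarrow> c \<odot>\<^bsub>W\<^esub> (a \<oplus>\<^bsub>W\<^esub> b) = c \<odot>\<^bsub>W\<^esub> a \<oplus>\<^bsub>W\<^esub> c \<odot>\<^bsub>W\<^esub> b"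
  unfolding smult_W by (rule ind_map_add) (auto simp: scale_closed scale_add scale_ract)

lemma smult_W_closed: "\<lbrakk>c \<in> carrier F; a \<in> carrier W\<rbrakk> \<Longrightarrow> c \<odot>\<^bsub>W\<^esub> a \<in> carrier W"
  unfolding smult_W by (rule ind_map_closed) (auto simp: scale_closed scale_add scale_ract)

text \<open>Scalars act on the first tensor factor, so each law holds for pure tensors because it
  holds pointwise in FG, and it spreads to sums because the action is additive.\<close>

theorem module_W: "module F W"
proof (rule moduleI)
  show "cring F" by (rule F.is_cring)
  show "abelian_group W" by (rule abelian_group_W)
next
  fix c d w assume c: "c \<in> carrier F" and d: "d \<in> carrier F" and w: "w \<in> carrier W"
  show "(c \<oplus>\<^bsub>F\<^esub> d) \<odot>\<^bsub>W\<^esub> w = c \<odot>\<^bsub>W\<^esub> w \<oplus>\<^bsub>W\<^esub> d \<odot>\<^bsub>W\<^esub> w" using w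
  proof (induction rule: W_induct)
    case (tens \<omega> v)
    have "group_algebra_scale F G (c \<oplus>\<^bsub>F\<^esub> d) \<omega> = group_algebra_scale F G c \<omega> \<oplus>\<^bsub>FG\<^esub> group_algebra_scale F G d \<omega>"
      by (rule FG_eqI) (use c d tens in \<open>auto simp: scale_closed scale_apply FG_add FG_add_closed FG_closed F.l_distr\<close>)
    then show ?case using c d tens by (simp add: smult_W_tens tens_add_left scale_closed)
  next
    case (add a b)
    then show ?case using c d by (simp add: smult_W_add smult_W_closed W.a_ac)
  qed
  show "(c \<otimes>\<^bsub>F\<^esub> d) \<odot>\<^bsub>W\<^esub> w = c \<odot>\<^bsub>W\<^esub> (d \<odot>\<^bsub>W\<^esub> w)" using w
  proof (induction rule: W_induct)
    case (tens \<omega> v)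
    have "group_algebra_scale F G (c \<otimes>\<^bsub>F\<^esub> d) \<omega> = group_algebra_scale F G c (group_algebra_scale F G d \<omega>)"
      by (rule FG_eqI) (use c d tens in \<open>auto simp: scale_closed scale_apply FG_closed F.m_assoc\<close>)
    then show ?case using c d tens by (simp add: smult_W_tens scale_closed)
  next
    case (add a b)
    then show ?case using c d by (simp add: smult_W_add smult_W_closed)
  qed
next
  fix w assume "w \<in> carrier W"
  then show "\<one>\<^bsub>F\<^esub> \<odot>\<^bsub>W\<^esub> w = w"
  proof (induction rule: W_induct)
    case (tens \<omega> v)
    have "group_algebra_scale F G \<one>\<^bsub>F\<^esub> \<omega> = \<omega>"
      by (rule FG_eqI) (use tens in \<open>auto simp: scale_closed scale_apply FG_closed\<close>)
    then show ?case using tens by (simp add: smult_W_tens)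
  next
    case (add a b)
    then show ?case by (simp add: smult_W_add)
  qed
qed (auto simp: smult_W_add smult_W_closed)

interpretation W: module F W by (rule module_W)

abbreviation "irep \<equiv> ind_rep F G L V \<sigma>"

lemma irep_tens:
  "\<lbrakk>g \<in> carrier G; \<omega> \<in> carrier FG; v \<in> carrier V\<rbrakk> \<Longrightarrow> irep g (tens \<omega> v) = tens (shift g \<omega>) v"
  unfolding ind_rep_def by (rule ind_map_tens) (auto simp: shift_closed shift_add shift_ract)

lemma irep_add:
  "\<lbrakk>g \<in> carrier G; a \<in> carrier W; b \<in> carrier W\<rbrakk> \<Longrightarrow> irep g (a \<oplus>\<^bsub>W\<^esub> b) = irep g a \<oplus>\<^bsub>W\<^esub> irep g b"
  unfolding ind_rep_def by (rule ind_map_add) (auto simp: shift_closed shift_add shift_ract)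

lemma irep_closed: "\<lbrakk>g \<in> carrier G; a \<in> carrier W\<rbrakk> \<Longrightarrow> irep g a \<in> carrier W"
  unfolding ind_rep_def by (rule ind_map_closed) (auto simp: shift_closed shift_add shift_ract)

lemma irep_smult:
  assumes "g \<in> carrier G" "c \<in> carrier F" "w \<in> carrier W"
  shows "irep g (c \<odot>\<^bsub>W\<^esub> w) = c \<odot>\<^bsub>W\<^esub> irep g w"
  using assms(3)
proof (induction rule: W_induct)
  case (tens \<omega> v)
  then show ?case using assms by (simp add: smult_W_tens irep_tens shift_scale scale_closed shift_closed)
next
  case (add a b)
  then show ?case using assms by (simp add: smult_W_add smult_W_closed irep_add irep_closed)
qed

lemma irep_extensional: "irep g \<in> extensional (carrier W)"
  unfolding ind_rep_def ind_map_def carrier_W by (rule T.tensor_map_extensional)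

theorem group_rep_irep: "group_rep F G W irep"
proof (rule group_repI)
  show "irep g \<in> linear_maps F W W" if "g \<in> carrier G" for g
    using that by (auto simp: linear_maps_def irep_add irep_smult irep_closed)
next
  fix g h w assume g: "g \<in> carrier G" and h: "h \<in> carrier G" and w: "w \<in> carrier W"
  show "irep (g \<otimes>\<^bsub>G\<^esub> h) w = irep g (irep h w)" using w
  proof (induction rule: W_induct)
    case (tens \<omega> v)
    then show ?case using g h by (simp add: irep_tens shift_closed shift_mult)
  next
    case (add a b)
    then show ?case using g h by (simp add: irep_add irep_closed)
  qed
next
  fix w assume "w \<in> carrier W"
  then show "irep \<one>\<^bsub>G\<^esub> w = w"
  proof (induction rule: W_induct)
    case (tens \<omega> v)
    then show ?case by (simp add: irep_tens shift_one)
  next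
    case (add a b)
    then show ?case by (simp add: irep_add)
  qed
qed (simp_all add: F.field_axioms module_W G.is_group irep_extensional)

text \<open>Both parts move an element c l of FL across the tensor sign: c = 1 gives the first and l
  = 1 the second. The second is what relates the scalars of W, defined through FG, to those of
  V.\<close>

lemma tens_basis_mult:
  assumes g: "g \<in> carrier G" and l: "l \<in> L" and v: "v \<in> carrier V"
  shows "tens (basis (g \<otimes>\<^bsub>G\<^esub> l)) v = tens (basis g) (\<sigma> l v)"
    and "c \<in> carrier F \<Longrightarrow> c \<odot>\<^bsub>W\<^esub> tens (basis g) v = tens (basis g) (c \<odot>\<^bsub>V\<^esub> v)"
proof -
  have *: "tens (group_algebra_scale F G c (basis (g \<otimes>\<^bsub>G\<^esub> l))) v = tens (basis g) (c \<odot>\<^bsub>V\<^esub> \<sigma> l v)"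
    if c: "c \<in> carrier F" and l: "l \<in> L" for c l
  proof -
    let ?s = "\<lambda>x\<in>L. if x = l then c else \<zero>\<^bsub>F\<^esub>"
    have s: "?s \<in> carrier FL" using c by (auto simp: carrier_FL)
    have "ract (basis g) ?s = group_algebra_scale F G c (basis (g \<otimes>\<^bsub>G\<^esub> l))"
    proof (rule FG_eqI)
      fix x assume x: "x \<in> carrier G"
      have e: "x \<otimes>\<^bsub>G\<^esub> inv\<^bsub>G\<^esub> l = g \<longleftrightarrow> x = g \<otimes>\<^bsub>G\<^esub> l"
        using x g L_in_G[OF l] by (metis G.inv_solve_right)
      have "ract (basis g) ?s x = (\<Oplus>\<^bsub>F\<^esub>m\<in>L. if l = m then basis g (x \<otimes>\<^bsub>G\<^esub> inv\<^bsub>G\<^esub> m) \<otimes>\<^bsub>F\<^esub> c else \<zero>\<^bsub>F\<^esub>)"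
        unfolding ract_apply[OF basis_closed s x]
        by (rule F.finsum_cong') (use x c in \<open>auto simp: L_in_G FG_closed[OF basis_closed]\<close>)
      also have "\<dots> = basis g (x \<otimes>\<^bsub>G\<^esub> inv\<^bsub>G\<^esub> l) \<otimes>\<^bsub>F\<^esub> c"
        by (rule F.finsum_singleton) (use x c l finite_L in \<open>auto simp: L_in_G FG_closed[OF basis_closed]\<close>)
      also have "\<dots> = group_algebra_scale F G c (basis (g \<otimes>\<^bsub>G\<^esub> l)) x"
        using x c l by (simp add: scale_apply basis_apply L_in_G e)
      finally show "ract (basis g) ?s x = group_algebra_scale F G c (basis (g \<otimes>\<^bsub>G\<^esub> l)) x" .
    qed (use s c in \<open>auto intro: ract_closed basis_closed scale_closed\<close>)
    then show ?thesis
      using tens_balanced[OF basis_closed[of g] s v] by (simp add: lact_single[OF l c v])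
  qed
  have "group_algebra_scale F G \<one>\<^bsub>F\<^esub> (basis (g \<otimes>\<^bsub>G\<^esub> l)) = basis (g \<otimes>\<^bsub>G\<^esub> l)"
    by (rule FG_eqI) (auto simp: scale_closed scale_apply basis_closed FG_closed[OF basis_closed])
  then show "tens (basis (g \<otimes>\<^bsub>G\<^esub> l)) v = tens (basis g) (\<sigma> l v)"
    using *[OF F.one_closed l] l v by (simp add: \<sigma>_closed)
  have "\<one>\<^bsub>G\<^esub> \<in> L" using subgroup.one_closed[OF subgroup_L] .
  then show "c \<in> carrier F \<Longrightarrow> c \<odot>\<^bsub>W\<^esub> tens (basis g) v = tens (basis g) (c \<odot>\<^bsub>V\<^esub> v)"
    using *[of c "\<one>\<^bsub>G\<^esub>"] g v by (simp add: smult_W_tens basis_closed \<sigma>_one)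
qed

section \<open>The subspaces g \<otimes> V and their coordinates\<close>

lemma tens_zero_right: "\<omega> \<in> carrier FG \<Longrightarrow> tens \<omega> \<zero>\<^bsub>V\<^esub> = \<zero>\<^bsub>W\<^esub>"
  using tens_add_right[of \<omega> "\<zero>\<^bsub>V\<^esub>" "\<zero>\<^bsub>V\<^esub>"] tens_closed[of \<omega> "\<zero>\<^bsub>V\<^esub>"] W.add.r_cancel_one by simp

definition summand :: "'g \<Rightarrow> ('g, 'f, 'v) ind_space set" where
  "summand g = tens (basis g) ` carrier V"

lemma summand_subset: "summand g \<subseteq> carrier W"
  by (auto simp: summand_def tens_closed basis_closed)

lemma submodule_summand:
  assumes g: "g \<in> carrier G"
  shows "submodule (summand g) F W"
proof (rule W.submoduleI)
  show "\<zero>\<^bsub>W\<^esub> \<in> summand g"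
    using tens_zero_right[OF basis_closed, of g] unfolding summand_def by (metis V.M.zero_closed imageI)
next
  fix a assume "a \<in> summand g"
  then obtain v where v: "v \<in> carrier V" "a = tens (basis g) v" by (auto simp: summand_def)
  have "\<ominus>\<^bsub>W\<^esub> a = tens (basis g) (\<ominus>\<^bsub>V\<^esub> v)"
    by (rule W.minus_equality) (use v in \<open>simp_all add: tens_closed basis_closed tens_add_right[symmetric] V.M.l_neg tens_zero_right\<close>)
  then show "\<ominus>\<^bsub>W\<^esub> a \<in> summand g" using v by (auto simp: summand_def)
next
  fix a b assume "a \<in> summand g" "b \<in> summand g"
  then show "a \<oplus>\<^bsub>W\<^esub> b \<in> summand g"
    by (auto simp: summand_def tens_add_right[symmetric] basis_closed)
next
  fix c a assume "c \<in> carrier F" "a \<in> summand g"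
  then show "c \<odot>\<^bsub>W\<^esub> a \<in> summand g"
    using g by (auto simp: summand_def tens_basis_mult(2)[OF _ subgroup.one_closed[OF subgroup_L]])
qed (rule summand_subset)

lemma irep_basis:
  "\<lbrakk>g \<in> carrier G; h \<in> carrier G; v \<in> carrier V\<rbrakk> \<Longrightarrow> irep g (tens (basis h) v) = tens (basis (g \<otimes>\<^bsub>G\<^esub> h)) v"
  by (simp add: irep_tens basis_closed shift_basis)

lemma irep_summand:
  assumes "g \<in> carrier G" "h \<in> carrier G"
  shows "irep g ` summand h = summand (g \<otimes>\<^bsub>G\<^esub> h)"
  unfolding summand_def image_image by (rule image_cong) (use assms in \<open>simp_all add: irep_basis\<close>)

text \<open>The component along \<open>g \<otimes> V\<close>; such an \<open>h\<close> exists by the universal property.\<close>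

definition coord :: "'g \<Rightarrow> ('g, 'f, 'v) ind_space \<Rightarrow> 'v" where
  "coord g = (SOME h. h \<in> hom T.tensor (add_monoid V) \<and>
     (\<forall>\<omega>\<in>carrier FG. \<forall>v\<in>carrier V. h (T.pure \<omega> v) = lact (restr g \<omega>) v))"

text \<open>The universal property applies because the assignment is balanced by
  \<open>lact_restr_ract\<close> and biadditive by \<open>lact_add_left\<close> and
  \<open>lact_add_right\<close>.\<close>

lemma coord:
  assumes g: "g \<in> carrier G"
  shows coord_tens: "\<lbrakk>\<omega> \<in> carrier FG; v \<in> carrier V\<rbrakk> \<Longrightarrow> coord g (tens \<omega> v) = lact (restr g \<omega>) v"
    and coord_add: "\<lbrakk>a \<in> carrier W; b \<in> carrier W\<rbrakk> \<Longrightarrow> coord g (a \<oplus>\<^bsub>W\<^esub> b) = coord g a \<oplus>\<^bsub>V\<^esub> coord g b"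
    and coord_closed: "a \<in> carrier W \<Longrightarrow> coord g a \<in> carrier V"
proof -
  obtain h where "h \<in> hom T.tensor (add_monoid V)"
    "\<And>\<omega> v. \<lbrakk>\<omega> \<in> carrier FG; v \<in> carrier V\<rbrakk> \<Longrightarrow> h (T.pure \<omega> v) = lact (restr g \<omega>) v"
  proof (rule T.tensor_universal[of "add_monoid V" "\<lambda>\<omega> v. lact (restr g \<omega>) v"])
    show "comm_group (add_monoid V)" by (rule V.M.a_comm_group)
  next
    fix a b v assume "a \<in> carrier FG" "b \<in> carrier FG" "v \<in> carrier V"
    then show "lact (restr g (a \<oplus>\<^bsub>FG\<^esub> b)) v = lact (restr g a) v \<otimes>\<^bsub>add_monoid V\<^esub> lact (restr g b) v"
      using g by (simp, intro lact_add_left) (auto simp: restr_closed FG_add_closed restr_apply FG_add L_in_G)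
  qed (use g in \<open>auto simp: lact_closed restr_closed lact_add_right lact_restr_ract\<close>)
  then have "\<exists>h. h \<in> hom T.tensor (add_monoid V) \<and>
     (\<forall>\<omega>\<in>carrier FG. \<forall>v\<in>carrier V. h (T.pure \<omega> v) = lact (restr g \<omega>) v)" by blast
  from someI_ex[OF this] have c: "coord g \<in> hom T.tensor (add_monoid V)"
    and p: "\<forall>\<omega>\<in>carrier FG. \<forall>v\<in>carrier V. coord g (T.pure \<omega> v) = lact (restr g \<omega>) v"
    unfolding coord_def by blast+
  show "\<lbrakk>\<omega> \<in> carrier FG; v \<in> carrier V\<rbrakk> \<Longrightarrow> coord g (tens \<omega> v) = lact (restr g \<omega>) v"
    using p by (simp add: tens_eq)
  show "\<lbrakk>a \<in> carrier W; b \<in> carrier W\<rbrakk> \<Longrightarrow> coord g (a \<oplus>\<^bsub>W\<^esub> b) = coord g a \<oplus>\<^bsub>V\<^esub> coord g b"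
    using hom_mult[OF c] by (simp add: carrier_W add_W)
  show "a \<in> carrier W \<Longrightarrow> coord g a \<in> carrier V"
    using hom_in_carrier[OF c] by (simp add: carrier_W)
qed

text \<open>On the coset gL, \<open>basis h\<close> is either the single point l = g^-1 h of L or
  zero. Thus coordinates separate the summands that belong to different cosets.\<close>

lemma coord_basis:
  assumes g: "g \<in> carrier G" and h: "h \<in> carrier G" and v: "v \<in> carrier V"
  shows "coord g (tens (basis h) v) =
    (if inv\<^bsub>G\<^esub> g \<otimes>\<^bsub>G\<^esub> h \<in> L then \<sigma> (inv\<^bsub>G\<^esub> g \<otimes>\<^bsub>G\<^esub> h) v else \<zero>\<^bsub>V\<^esub>)"
proof -
  let ?l = "inv\<^bsub>G\<^esub> g \<otimes>\<^bsub>G\<^esub> h"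
  have e: "g \<otimes>\<^bsub>G\<^esub> x = h \<longleftrightarrow> x = ?l" if "x \<in> L" for x
    using g h L_in_G[OF that] by (metis G.inv_solve_left)
  have r: "restr g (basis h) = (\<lambda>x\<in>L. if x = ?l then \<one>\<^bsub>F\<^esub> else \<zero>\<^bsub>F\<^esub>)"
    using g by (auto simp: restr_def basis_apply L_in_G e)
  show ?thesis
  proof (cases "?l \<in> L")
    case True
    then show ?thesis using g h v lact_single[OF True F.one_closed v]
      by (simp add: coord_tens basis_closed r \<sigma>_closed)
  next
    case False
    then have "lact (restr g (basis h)) v = (\<Oplus>\<^bsub>V\<^esub>x\<in>L. \<zero>\<^bsub>V\<^esub>)"
      unfolding r group_algebra_lact_def
      by (intro V.M.finsum_cong') (use v in \<open>auto simp: \<sigma>_closed\<close>)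
    then show ?thesis using g v False by (simp add: coord_tens basis_closed)
  qed
qed

lemma coord_zero: "g \<in> carrier G \<Longrightarrow> coord g \<zero>\<^bsub>W\<^esub> = \<zero>\<^bsub>V\<^esub>"
  using coord_add[of g "\<zero>\<^bsub>W\<^esub>" "\<zero>\<^bsub>W\<^esub>"] coord_closed[of g "\<zero>\<^bsub>W\<^esub>"] V.M.add.r_cancel_one by simp

text \<open>\<open>coord g\<close> is a left inverse, as g^-1 g = 1 acts trivially. This yields the
  isomorphism of V with 1 \<otimes> V.\<close>

lemma inj_tens_basis:
  assumes g: "g \<in> carrier G"
  shows "inj_on (tens (basis g)) (carrier V)"
proof (rule inj_on_inverseI[where g = "coord g"])
  show "coord g (tens (basis g) v) = v" if "v \<in> carrier V" for v
    using g that subgroup.one_closed[OF subgroup_L] by (simp add: coord_basis \<sigma>_one)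
qed

end

section \<open>Decomposition along a left transversal, and the kernel\<close>

locale induced_transversal = induced F G L V \<sigma>
  for F :: "'f ring" and G :: "'g monoid" and L :: "'g set" and V :: "('f, 'v) module"
    and \<sigma> :: "'g \<Rightarrow> 'v \<Rightarrow> 'v" +
  fixes I :: "'i set" and r :: "'i \<Rightarrow> 'g"
  assumes finite_I: "finite I" and r_closed: "i \<in> I \<Longrightarrow> r i \<in> carrier G"
    and transversal: "g \<in> carrier G \<Longrightarrow> \<exists>!i. i \<in> I \<and> inv\<^bsub>G\<^esub> (r i) \<otimes>\<^bsub>G\<^esub> g \<in> L"
begin

interpretation W: module F W by (rule module_W)

lemma transversal_unique:
  assumes "i \<in> I" "j \<in> I" "inv\<^bsub>G\<^esub> (r i) \<otimes>\<^bsub>G\<^esub> r j \<in> L"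
  shows "i = j"
  using transversal[OF r_closed[OF assms(2)]] assms subgroup.one_closed[OF subgroup_L]
  by (metis G.l_inv r_closed)

text \<open>Cutting \<open>\<omega>\<close> into its restrictions to the cosets of \<open>L\<close> exhibits \<open>FG\<close> as a free right
  \<open>FL\<close>-module.\<close>

lemma FG_decomp:
  assumes w: "\<omega> \<in> carrier FG"
  shows "\<omega> = (\<Oplus>\<^bsub>FG\<^esub>i\<in>I. ract (basis (r i)) (restr (r i) \<omega>))"
proof (rule FG_eqI)
  have c: "(\<lambda>i. ract (basis (r i)) (restr (r i) \<omega>)) \<in> I \<rightarrow> carrier FG"
    using w by (auto intro!: ract_closed basis_closed restr_closed r_closed)
  then show "(\<Oplus>\<^bsub>FG\<^esub>i\<in>I. ract (basis (r i)) (restr (r i) \<omega>)) \<in> carrier FG"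
    by (rule T.M.finsum_closed)
  fix x assume x: "x \<in> carrier G"
  \<comment> \<open>\<open>j\<close> indexes the coset of L that contains \<open>x\<close>, the only
    one whose piece of \<omega> is supported at \<open>x\<close>.\<close>
  obtain j where j: "j \<in> I" "inv\<^bsub>G\<^esub> (r j) \<otimes>\<^bsub>G\<^esub> x \<in> L" using transversal[OF x] by blast
  have *: "ract (basis (r i)) (restr (r i) \<omega>) x = (if j = i then \<omega> x else \<zero>\<^bsub>F\<^esub>)" if i: "i \<in> I" for i
  proof -
    let ?l = "inv\<^bsub>G\<^esub> (r i) \<otimes>\<^bsub>G\<^esub> x"
    note ri = r_closed[OF i]
    have e: "x \<otimes>\<^bsub>G\<^esub> inv\<^bsub>G\<^esub> m = r i \<longleftrightarrow> ?l = m" if "m \<in> L" for m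
      using x ri L_in_G[OF that] by (metis G.inv_solve_left G.inv_solve_right)
    have "ract (basis (r i)) (restr (r i) \<omega>) x = (\<Oplus>\<^bsub>F\<^esub>m\<in>L. if ?l = m then \<omega> (r i \<otimes>\<^bsub>G\<^esub> m) else \<zero>\<^bsub>F\<^esub>)"
      unfolding ract_apply[OF basis_closed restr_closed[OF ri w] x]
      by (rule F.finsum_cong') (use x ri w in \<open>auto simp: e basis_apply L_in_G restr_apply FG_closed\<close>)
    also have "\<dots> = (if ?l \<in> L then \<omega> x else \<zero>\<^bsub>F\<^esub>)"
    proof (cases "?l \<in> L")
      case True
      have "(\<Oplus>\<^bsub>F\<^esub>m\<in>L. if ?l = m then \<omega> (r i \<otimes>\<^bsub>G\<^esub> m) else \<zero>\<^bsub>F\<^esub>) = \<omega> (r i \<otimes>\<^bsub>G\<^esub> ?l)"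
        by (rule F.finsum_singleton) (use True ri w finite_L in \<open>auto simp: L_in_G FG_closed\<close>)
      then show ?thesis using True x ri by (simp add: G.m_assoc[symmetric])
    next
      case False
      then have "(\<Oplus>\<^bsub>F\<^esub>m\<in>L. if ?l = m then \<omega> (r i \<otimes>\<^bsub>G\<^esub> m) else \<zero>\<^bsub>F\<^esub>) = (\<Oplus>\<^bsub>F\<^esub>m\<in>L. \<zero>\<^bsub>F\<^esub>)"
        by (intro F.finsum_cong') auto
      then show ?thesis using False by simp
    qed
    also have "?l \<in> L \<longleftrightarrow> j = i" using transversal[OF x] i j by blast
    finally show ?thesis .
  qed
  have "(\<Oplus>\<^bsub>FG\<^esub>i\<in>I. ract (basis (r i)) (restr (r i) \<omega>)) x = (\<Oplus>\<^bsub>F\<^esub>i\<in>I. if j = i then \<omega> x else \<zero>\<^bsub>F\<^esub>)"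
    unfolding finsum_FG_apply[OF finite_I c x]
    by (rule F.finsum_cong') (use * w x in \<open>auto simp: FG_closed\<close>)
  also have "\<dots> = \<omega> x"
    by (rule F.finsum_singleton) (use j finite_I w x in \<open>auto simp: FG_closed\<close>)
  finally show "\<omega> x = (\<Oplus>\<^bsub>FG\<^esub>i\<in>I. ract (basis (r i)) (restr (r i) \<omega>)) x" ..
qed (rule w)

text \<open>For \<omega> \<otimes> v, cut \<omega> by \<open>FG_decomp\<close> and move each
  restriction across the tensor sign; what arrives in V is the coordinate. Both sides are additive
  in \<open>w\<close>.\<close>

lemma W_decomp:
  assumes "w \<in> carrier W"
  shows "w = (\<Oplus>\<^bsub>W\<^esub>i\<in>I. tens (basis (r i)) (coord (r i) w))"
  using assms
proof (induction rule: W_induct)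
  case (tens \<omega> v)
  let ?f = "\<lambda>i. ract (basis (r i)) (restr (r i) \<omega>)"
  have c: "?f \<in> I \<rightarrow> carrier FG"
    using tens by (auto intro!: ract_closed basis_closed restr_closed r_closed)
  have "tens \<omega> v = tens (\<Oplus>\<^bsub>FG\<^esub>i\<in>I. ?f i) v" using FG_decomp[OF tens(1)] by simp
  also have "\<dots> = (\<Oplus>\<^bsub>W\<^esub>i\<in>I. tens (?f i) v)"
    by (rule T.M.additive_finsum[where h = "\<lambda>a. tens a v"])
      (use c tens finite_I in \<open>auto simp: tens_add_left tens_zero_left tens_closed W.M.abelian_monoid_axioms\<close>)
  also have "\<dots> = (\<Oplus>\<^bsub>W\<^esub>i\<in>I. tens (basis (r i)) (coord (r i) (tens \<omega> v)))"
    by (rule W.M.finsum_cong')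
      (use tens in \<open>auto simp: tens_balanced basis_closed restr_closed r_closed coord_tens lact_closed tens_closed\<close>)
  finally show ?case .
next
  case (add a b)
  have "a \<oplus>\<^bsub>W\<^esub> b = (\<Oplus>\<^bsub>W\<^esub>i\<in>I. tens (basis (r i)) (coord (r i) a)) \<oplus>\<^bsub>W\<^esub>
      (\<Oplus>\<^bsub>W\<^esub>i\<in>I. tens (basis (r i)) (coord (r i) b))"
    using add by simp
  also have "\<dots> = (\<Oplus>\<^bsub>W\<^esub>i\<in>I. tens (basis (r i)) (coord (r i) a) \<oplus>\<^bsub>W\<^esub> tens (basis (r i)) (coord (r i) b))"
    by (rule W.M.finsum_addf[symmetric]) (use add in \<open>auto intro!: tens_closed basis_closed coord_closed r_closed\<close>)
  also have "\<dots> = (\<Oplus>\<^bsub>W\<^esub>i\<in>I. tens (basis (r i)) (coord (r i) (a \<oplus>\<^bsub>W\<^esub> b)))"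
    by (rule W.M.finsum_cong')
      (use add in \<open>auto simp: coord_add r_closed tens_add_right basis_closed coord_closed intro!: tens_closed\<close>)
  finally show ?case .
qed

text \<open>The terms with i \<noteq> j vanish because r_j^-1 r_i lies in L only for i = j. The
  coefficients of an expansion are therefore determined by the vector.\<close>

lemma coord_finsum:
  assumes j: "j \<in> I" and v: "\<And>i. i \<in> I \<Longrightarrow> v i \<in> carrier V"
  shows "coord (r j) (\<Oplus>\<^bsub>W\<^esub>i\<in>I. tens (basis (r i)) (v i)) = v j"
proof -
  have "coord (r j) (\<Oplus>\<^bsub>W\<^esub>i\<in>I. tens (basis (r i)) (v i)) = (\<Oplus>\<^bsub>V\<^esub>i\<in>I. coord (r j) (tens (basis (r i)) (v i)))"
    by (rule W.M.additive_finsum[where h = "coord (r j)"])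
      (use j v finite_I in \<open>auto simp: coord_add r_closed coord_zero coord_closed V.M.abelian_monoid_axioms tens_closed basis_closed\<close>)
  also have "\<dots> = (\<Oplus>\<^bsub>V\<^esub>i\<in>I. if j = i then v i else \<zero>\<^bsub>V\<^esub>)"
  proof (rule V.M.finsum_cong'[OF refl])
    fix i assume i: "i \<in> I"
    show "coord (r j) (tens (basis (r i)) (v i)) = (if j = i then v i else \<zero>\<^bsub>V\<^esub>)"
      using i j v transversal_unique[OF j i] subgroup.one_closed[OF subgroup_L]
      by (auto simp: coord_basis r_closed \<sigma>_one)
  qed (use v in auto)
  also have "\<dots> = v j"
    by (rule V.M.finsum_singleton) (use j v finite_I in auto)
  finally show ?thesis .
qed

text \<open>Translating 1 \<otimes> V by r_i gives r_i \<otimes> V; existence of the expansion is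
  then \<open>W_decomp\<close> and uniqueness is \<open>coord_finsum\<close>.\<close>

theorem direct_sum: "internal_direct_sum F W I (\<lambda>i. irep (r i) ` summand \<one>\<^bsub>G\<^esub>)"
proof -
  have s: "irep (r i) ` summand \<one>\<^bsub>G\<^esub> = summand (r i)" if "i \<in> I" for i
    using irep_summand[of "r i" "\<one>\<^bsub>G\<^esub>"] r_closed[OF that] by simp
  have P: "(\<Pi>\<^sub>E i\<in>I. irep (r i) ` summand \<one>\<^bsub>G\<^esub>) = (\<Pi>\<^sub>E i\<in>I. summand (r i))"
    by (rule PiE_cong) (rule s)
  have "\<exists>!f. f \<in> (\<Pi>\<^sub>E i\<in>I. irep (r i) ` summand \<one>\<^bsub>G\<^esub>) \<and> w = (\<Oplus>\<^bsub>W\<^esub>i\<in>I. f i)"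
    if w: "w \<in> carrier W" for w
  proof (rule ex1I)
    let ?f = "\<lambda>i\<in>I. tens (basis (r i)) (coord (r i) w)"
    have "w = (\<Oplus>\<^bsub>W\<^esub>i\<in>I. tens (basis (r i)) (coord (r i) w))" by (rule W_decomp[OF w])
    also have "\<dots> = (\<Oplus>\<^bsub>W\<^esub>i\<in>I. ?f i)"
      by (rule W.M.finsum_cong') (use w in \<open>auto intro!: tens_closed basis_closed coord_closed r_closed\<close>)
    finally show "?f \<in> (\<Pi>\<^sub>E i\<in>I. irep (r i) ` summand \<one>\<^bsub>G\<^esub>) \<and> w = (\<Oplus>\<^bsub>W\<^esub>i\<in>I. ?f i)"
      using w unfolding P by (auto simp: summand_def coord_closed r_closed)
  next
    fix f assume f: "f \<in> (\<Pi>\<^sub>E i\<in>I. irep (r i) ` summand \<one>\<^bsub>G\<^esub>) \<and> w = (\<Oplus>\<^bsub>W\<^esub>i\<in>I. f i)"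
    then have "\<forall>i\<in>I. \<exists>v. v \<in> carrier V \<and> f i = tens (basis (r i)) v"
      unfolding P by (auto simp: PiE_iff summand_def)
    then obtain v where "\<forall>i\<in>I. v i \<in> carrier V \<and> f i = tens (basis (r i)) (v i)"
      unfolding bchoice_iff by blast
    then have v: "\<And>i. i \<in> I \<Longrightarrow> v i \<in> carrier V" "\<And>i. i \<in> I \<Longrightarrow> f i = tens (basis (r i)) (v i)"
      by blast+
    have "w = (\<Oplus>\<^bsub>W\<^esub>i\<in>I. tens (basis (r i)) (v i))"
      using f by (simp, intro W.M.finsum_cong') (auto simp: v tens_closed basis_closed)
    then have "coord (r j) w = v j" if "j \<in> I" for j
      using coord_finsum[OF that v(1)] by simp
    then show "f = (\<lambda>i\<in>I. tens (basis (r i)) (coord (r i) w))"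
      using f v(2) by (intro extensionalityI[of _ I]) (auto simp: PiE_iff)
  qed
  then show ?thesis
    by (simp add: internal_direct_sum_def finite_I s submodule_summand r_closed)
qed

text \<open>On a nonzero space the kernel of an induced representation is the normal core of the
  kernel of \<sigma>. By \<open>tr\<close> and \<open>ker\<close> the latter is T, which is already
  normal in G; \<open>triv\<close> handles the zero space.\<close>

theorem kernel_irep:
  assumes T: "T \<lhd> G" "T \<subseteq> L" and tr: "\<And>t v. \<lbrakk>t \<in> T; v \<in> carrier V\<rbrakk> \<Longrightarrow> \<sigma> t v = v"
    and ker: "\<And>l. \<lbrakk>l \<in> L; \<And>v. v \<in> carrier V \<Longrightarrow> \<sigma> l v = v\<rbrakk> \<Longrightarrow> l \<in> T"
    and triv: "carrier V = {\<zero>\<^bsub>V\<^esub>} \<Longrightarrow> L = carrier G"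
  shows "kernel G (GL F W) irep = T"
proof -
  interpret T: normal T G by fact
  have "irep t w = w" if t: "t \<in> T" and w: "w \<in> carrier W" for t w
  proof -
    have tG: "t \<in> carrier G" using t T.mem_carrier by blast
    have b: "irep t (tens (basis g) v) = tens (basis g) v" if g: "g \<in> carrier G" and v: "v \<in> carrier V" for g v
    proof -
      \<comment> \<open>From t g = g u, the element t acts on g \<otimes> v through \<sigma>(u), and
        normality puts u back into T.\<close>
      let ?u = "inv\<^bsub>G\<^esub> g \<otimes>\<^bsub>G\<^esub> t \<otimes>\<^bsub>G\<^esub> g"
      have u: "?u \<in> T" using T.inv_op_closed1[OF g t] .
      have "t \<otimes>\<^bsub>G\<^esub> g = g \<otimes>\<^bsub>G\<^esub> ?u" using g tG by (simp add: G.m_assoc[symmetric])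
      then have "irep t (tens (basis g) v) = tens (basis g) (\<sigma> ?u v)"
        using tens_basis_mult(1)[OF g _ v, of ?u] u T(2) irep_basis[OF tG g v] by auto
      then show ?thesis using tr[OF u v] by simp
    qed
    \<comment> \<open>The vectors r_i \<otimes> v span W additively by \<open>W_decomp\<close>, so
      fixing them is enough.\<close>
    have c: "(\<lambda>i. tens (basis (r i)) (coord (r i) w)) \<in> I \<rightarrow> carrier W"
      using w by (auto intro!: tens_closed basis_closed coord_closed r_closed)
    have "irep t (\<Oplus>\<^bsub>W\<^esub>i\<in>I. tens (basis (r i)) (coord (r i) w)) =
        (\<Oplus>\<^bsub>W\<^esub>i\<in>I. irep t (tens (basis (r i)) (coord (r i) w)))"
      using irep_smult[OF tG F.zero_closed W.M.zero_closed] irep_closed[OF tG W.M.zero_closed]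
      by (intro W.M.additive_finsum[OF _ _ _ _ c finite_I])
        (simp_all add: W.M.abelian_monoid_axioms irep_add tG irep_closed)
    also have "\<dots> = (\<Oplus>\<^bsub>W\<^esub>i\<in>I. tens (basis (r i)) (coord (r i) w))"
      by (rule W.M.finsum_cong'[OF refl c]) (simp add: b r_closed coord_closed w)
    finally show ?thesis using W_decomp[OF w] by simp
  qed
  moreover have "g \<in> T" if g: "g \<in> carrier G" and fix_g: "\<And>w. w \<in> carrier W \<Longrightarrow> irep g w = w" for g
  proof -
    \<comment> \<open>As g fixes 1 \<otimes> v, the tensors g \<otimes> v and 1 \<otimes> v agree,
      and so do their coordinates at the identity.\<close>
    have *: "(if g \<in> L then \<sigma> g v else \<zero>\<^bsub>V\<^esub>) = v" if v: "v \<in> carrier V" for v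
    proof -
      have "tens (basis g) v = tens (basis \<one>\<^bsub>G\<^esub>) v"
        using fix_g[OF tens_closed[OF basis_closed v, of "\<one>\<^bsub>G\<^esub>"]] irep_basis[OF g G.one_closed v] g by simp
      then have "coord \<one>\<^bsub>G\<^esub> (tens (basis g) v) = coord \<one>\<^bsub>G\<^esub> (tens (basis \<one>\<^bsub>G\<^esub>) v)" by simp
      then show ?thesis
        using g v subgroup.one_closed[OF subgroup_L] by (simp add: coord_basis \<sigma>_one split: if_splits)
    qed
    have "g \<in> L"
    proof (rule ccontr)
      assume "g \<notin> L"
      then have "carrier V = {\<zero>\<^bsub>V\<^esub>}" using * by auto
      then show False using triv g \<open>g \<notin> L\<close> by blast
    qed
    then show ?thesis using ker * by simp
  qed
  \<comment> \<open>Kernel membership is an equality of functions, so agreement with the identity on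
    the carrier must be completed outside it.\<close>
  moreover have "irep g \<in> extensional (carrier W)" for g by (rule irep_extensional)
  ultimately show ?thesis
    using T.subset
    by (auto simp: kernel_def one_GL fun_eq_iff extensional_def dest: fun_cong)
qed

end

section \<open>Trifactorised groups of skew left braces\<close>

lemma (in group) inv_mult_cancel: "\<lbrakk>a \<in> carrier G; b \<in> carrier G\<rbrakk> \<Longrightarrow> inv a \<otimes> (a \<otimes> b) = b"
  by (simp add: m_assoc[symmetric])

lemma (in group) mult_inv_cancel: "\<lbrakk>a \<in> carrier G; b \<in> carrier G\<rbrakk> \<Longrightarrow> a \<otimes> (inv a \<otimes> b) = b"
  by (simp add: m_assoc[symmetric])

text \<open>\<open>I\<close> is an arbitrary ideal here; the kernel of \<rho> is substituted for it
  in the final theorem.\<close>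

locale brace_trifactorisation =
  fixes B :: "'g ring" and G :: "'g monoid" and K H E I :: "'g set" and \<eta> :: "'g \<Rightarrow> 'g"
  assumes brace: "skew_left_brace B" and trifactorised: "trifactorised_group G K H E"
    and epi: "associated_epi B G K H E \<eta>" and ideal: "brace_ideal B I"
begin

definition T :: "'g set" where "T = (I <#>\<^bsub>G\<^esub> H) \<inter> (I <#>\<^bsub>G\<^esub> E)"

lemma group_G: "group G" and finite_G: "finite (carrier G)" and normal_K: "K \<lhd> G"
  and subgroup_H: "subgroup H G" and subgroup_E: "subgroup E G"
  and G_eq_KE: "carrier G = K <#>\<^bsub>G\<^esub> E" and K_Int_E: "K \<inter> E = {\<one>\<^bsub>G\<^esub>}"
  and G_eq_KH: "carrier G = K <#>\<^bsub>G\<^esub> H"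
  using trifactorised by (auto simp: trifactorised_group_def)

lemma K_eq: "K = carrier B" and B_add: "\<lbrakk>a \<in> K; b \<in> K\<rbrakk> \<Longrightarrow> a \<oplus>\<^bsub>B\<^esub> b = a \<otimes>\<^bsub>G\<^esub> b"
  and \<eta>_hom: "\<eta> \<in> hom B (G\<lparr>carrier := E\<rparr>)" and \<eta>_image: "\<eta> ` K = E"
  and \<eta>_conj: "\<lbrakk>c \<in> K; k \<in> K\<rbrakk> \<Longrightarrow> \<eta> c \<otimes>\<^bsub>G\<^esub> k \<otimes>\<^bsub>G\<^esub> inv\<^bsub>G\<^esub> (\<eta> c) = brace_lambda B c k"
  and H_eq: "H = {c \<otimes>\<^bsub>G\<^esub> \<eta> c | c. c \<in> K}"
  using epi by (auto simp: associated_epi_def)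

interpretation G: group G by (rule group_G)
interpretation K: normal K G by (rule normal_K)
interpretation E: subgroup E G by (rule subgroup_E)
interpretation A: group "add_monoid B" using brace by (simp add: skew_left_brace_def)
interpretation B: group B using brace by (simp add: skew_left_brace_def)
interpretation IA: normal I "add_monoid B" using ideal by (simp add: brace_ideal_def)
interpretation IB: normal I B using ideal by (simp add: brace_ideal_def)

lemma lambda_ideal: "\<lbrakk>c \<in> K; i \<in> I\<rbrakk> \<Longrightarrow> brace_lambda B c i \<in> I"
  using ideal by (auto simp: brace_ideal_def K_eq)

lemma I_in_K: "i \<in> I \<Longrightarrow> i \<in> K"
  using IB.subset by (auto simp: K_eq)

text \<open>\<open>associated_epi\<close> only identifies the additions on \<open>K\<close>. The
  zero of the brace is recovered as an idempotent of the group \<open>G\<close>; inverses then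
  follow in \<open>B_minus\<close>.\<close>

lemma B_zero: "\<zero>\<^bsub>B\<^esub> = \<one>\<^bsub>G\<^esub>"
proof -
  have z: "\<zero>\<^bsub>B\<^esub> \<in> K" using A.one_closed by (simp add: K_eq)
  have "\<zero>\<^bsub>B\<^esub> \<oplus>\<^bsub>B\<^esub> \<zero>\<^bsub>B\<^esub> = \<zero>\<^bsub>B\<^esub>" using A.l_one[of "\<zero>\<^bsub>B\<^esub>"] A.one_closed by simp
  then show ?thesis using B_add[OF z z] G.l_cancel_one'[of "\<zero>\<^bsub>B\<^esub>" "\<zero>\<^bsub>B\<^esub>"] K.mem_carrier[OF z] by simp
qed

lemma B_minus: "a \<in> K \<Longrightarrow> \<ominus>\<^bsub>B\<^esub> a = inv\<^bsub>G\<^esub> a"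
proof -
  assume a: "a \<in> K"
  have m: "\<ominus>\<^bsub>B\<^esub> a \<in> K" using A.inv_closed[of a] a by (simp add: K_eq a_inv_def)
  have "\<ominus>\<^bsub>B\<^esub> a \<oplus>\<^bsub>B\<^esub> a = \<zero>\<^bsub>B\<^esub>" using A.l_inv[of a] a by (simp add: K_eq a_inv_def)
  then show ?thesis
    using B_add[OF m a] B_zero G.inv_equality[of "\<ominus>\<^bsub>B\<^esub> a" a] K.mem_carrier a m by simp
qed

lemma B_mult_closed: "\<lbrakk>a \<in> K; b \<in> K\<rbrakk> \<Longrightarrow> a \<otimes>\<^bsub>B\<^esub> b \<in> K"
  by (simp add: K_eq)

lemma lambda_eq: "\<lbrakk>c \<in> K; k \<in> K\<rbrakk> \<Longrightarrow> brace_lambda B c k = inv\<^bsub>G\<^esub> c \<otimes>\<^bsub>G\<^esub> (c \<otimes>\<^bsub>B\<^esub> k)"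
  by (simp add: brace_lambda_def B_minus B_add B_mult_closed)

lemma \<eta>_in_E: "c \<in> K \<Longrightarrow> \<eta> c \<in> E"
  using \<eta>_image by auto

lemma \<eta>_in_G: "c \<in> K \<Longrightarrow> \<eta> c \<in> carrier G"
  using \<eta>_in_E E.mem_carrier by blast

lemma \<eta>_mult: "\<lbrakk>c \<in> K; d \<in> K\<rbrakk> \<Longrightarrow> \<eta> (c \<otimes>\<^bsub>B\<^esub> d) = \<eta> c \<otimes>\<^bsub>G\<^esub> \<eta> d"
  using hom_mult[OF \<eta>_hom] by (simp add: K_eq)

lemma \<eta>_one: "\<eta> \<one>\<^bsub>B\<^esub> = \<one>\<^bsub>G\<^esub>"
  using hom_one[OF \<eta>_hom B.is_group G.subgroup_imp_group[OF subgroup_E]] by simp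

lemma \<eta>_inv: "c \<in> K \<Longrightarrow> \<eta> (inv\<^bsub>B\<^esub> c) = inv\<^bsub>G\<^esub> (\<eta> c)"
  by (rule G.inv_equality[symmetric])
    (simp_all add: \<eta>_mult[symmetric] \<eta>_one \<eta>_in_G K_eq \<eta>_in_G[unfolded K_eq] \<eta>_mult[unfolded K_eq, symmetric])

lemma KE_decomp:
  assumes "g \<in> carrier G"
  obtains k e where "k \<in> K" "e \<in> E" "g = k \<otimes>\<^bsub>G\<^esub> e"
  using assms unfolding G_eq_KE set_mult_def by blast

lemma K_Int_E_D: "\<lbrakk>x \<in> K; x \<in> E\<rbrakk> \<Longrightarrow> x = \<one>\<^bsub>G\<^esub>"
  using K_Int_E by blast

text \<open>Since G = KE and E = \<eta>(K), invariance can be tested separately under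
  \<open>K\<close> and under the elements \<eta>(c). Both I and T are treated in this way.\<close>

lemma normal_via_KE:
  assumes N: "subgroup N G"
    and k: "\<And>k n. \<lbrakk>k \<in> K; n \<in> N\<rbrakk> \<Longrightarrow> k \<otimes>\<^bsub>G\<^esub> n \<otimes>\<^bsub>G\<^esub> inv\<^bsub>G\<^esub> k \<in> N"
    and e: "\<And>c n. \<lbrakk>c \<in> K; n \<in> N\<rbrakk> \<Longrightarrow> \<eta> c \<otimes>\<^bsub>G\<^esub> n \<otimes>\<^bsub>G\<^esub> inv\<^bsub>G\<^esub> (\<eta> c) \<in> N"
  shows "N \<lhd> G"
proof (rule G.normal_invI[OF N])
  fix g n assume g: "g \<in> carrier G" and n: "n \<in> N"
  obtain x c where x: "x \<in> K" "c \<in> K" and gx: "g = x \<otimes>\<^bsub>G\<^esub> \<eta> c"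
    using KE_decomp[OF g] \<eta>_image by (metis imageE)
  have "g \<otimes>\<^bsub>G\<^esub> n \<otimes>\<^bsub>G\<^esub> inv\<^bsub>G\<^esub> g = x \<otimes>\<^bsub>G\<^esub> (\<eta> c \<otimes>\<^bsub>G\<^esub> n \<otimes>\<^bsub>G\<^esub> inv\<^bsub>G\<^esub> (\<eta> c)) \<otimes>\<^bsub>G\<^esub> inv\<^bsub>G\<^esub> x"
    using x subgroup.mem_carrier[OF N n] by (simp add: gx \<eta>_in_G K.mem_carrier G.inv_mult_group G.m_assoc)
  then show "g \<otimes>\<^bsub>G\<^esub> n \<otimes>\<^bsub>G\<^esub> inv\<^bsub>G\<^esub> g \<in> N"
    using k[OF x(1) e[OF x(2) n]] by simp
qed

lemma subgroup_I: "subgroup I G"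
proof (rule G.subgroupI)
  show "I \<subseteq> carrier G" using I_in_K K.mem_carrier by blast
  show "I \<noteq> {}" using IB.one_closed by blast
  show "inv\<^bsub>G\<^esub> i \<in> I" if "i \<in> I" for i
    using IA.m_inv_closed[OF that] B_minus[OF I_in_K[OF that]] by (simp add: a_inv_def)
  show "i \<otimes>\<^bsub>G\<^esub> j \<in> I" if "i \<in> I" "j \<in> I" for i j
    using IA.m_closed[OF that] B_add[OF I_in_K I_in_K, OF that] by simp
qed

text \<open>Conjugation by \<open>K\<close> is additive conjugation in the brace, and conjugation by
  \<eta>(c) is \<lambda>_c; an ideal is stable under both.\<close>

lemma normal_I: "I \<lhd> G"
proof (rule normal_via_KE[OF subgroup_I])
  fix k i assume k: "k \<in> K" and i: "i \<in> I"
  have "(k \<oplus>\<^bsub>B\<^esub> i) \<oplus>\<^bsub>B\<^esub> (\<ominus>\<^bsub>B\<^esub> k) \<in> I"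
    using IA.inv_op_closed2[of k i] k i by (simp add: K_eq a_inv_def)
  then show "k \<otimes>\<^bsub>G\<^esub> i \<otimes>\<^bsub>G\<^esub> inv\<^bsub>G\<^esub> k \<in> I"
    using k I_in_K[OF i] by (simp add: B_minus B_add)
next
  fix c i assume "c \<in> K" "i \<in> I"
  then show "\<eta> c \<otimes>\<^bsub>G\<^esub> i \<otimes>\<^bsub>G\<^esub> inv\<^bsub>G\<^esub> (\<eta> c) \<in> I"
    by (simp add: \<eta>_conj I_in_K lambda_ideal)
qed

interpretation I: normal I G by (rule normal_I)

section \<open>The normal subgroup T and the subgroup KT\<close>

lemma T_iff: "x \<in> T \<longleftrightarrow> (\<exists>i\<in>I. \<exists>c\<in>I. x = i \<otimes>\<^bsub>G\<^esub> \<eta> c)"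
proof
  assume "x \<in> T"
  then obtain i h j e where i: "i \<in> I" and h: "h \<in> H" "x = i \<otimes>\<^bsub>G\<^esub> h"
    and j: "j \<in> I" and e: "e \<in> E" "x = j \<otimes>\<^bsub>G\<^esub> e"
    unfolding T_def set_mult_def by blast
  obtain c where c: "c \<in> K" and xi: "x = i \<otimes>\<^bsub>G\<^esub> (c \<otimes>\<^bsub>G\<^esub> \<eta> c)" using h H_eq by blast
  obtain d where d: "d \<in> K" and xj: "x = j \<otimes>\<^bsub>G\<^esub> \<eta> d" using e \<eta>_image by blast
  note [simp] = \<eta>_in_G[OF c] \<eta>_in_G[OF d] I.mem_carrier[OF i] I.mem_carrier[OF j] K.mem_carrier[OF c]
  \<comment> \<open>Equating the two factorisations of \<open>x\<close> and sorting the factors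
    exhibits an element of \<open>K\<close> that equals one of \<open>E\<close>.\<close>
  have "inv\<^bsub>G\<^esub> j \<otimes>\<^bsub>G\<^esub> (i \<otimes>\<^bsub>G\<^esub> c) = inv\<^bsub>G\<^esub> j \<otimes>\<^bsub>G\<^esub> (x \<otimes>\<^bsub>G\<^esub> inv\<^bsub>G\<^esub> (\<eta> c))"
    by (simp add: xi G.m_assoc)
  also have "\<dots> = \<eta> d \<otimes>\<^bsub>G\<^esub> inv\<^bsub>G\<^esub> (\<eta> c)"
    by (simp add: xj G.m_assoc[symmetric])
  finally have eq: "inv\<^bsub>G\<^esub> j \<otimes>\<^bsub>G\<^esub> (i \<otimes>\<^bsub>G\<^esub> c) = \<eta> d \<otimes>\<^bsub>G\<^esub> inv\<^bsub>G\<^esub> (\<eta> c)" .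
  have "inv\<^bsub>G\<^esub> j \<otimes>\<^bsub>G\<^esub> (i \<otimes>\<^bsub>G\<^esub> c) \<in> K"
    using I_in_K[OF i] I_in_K[OF j] c by simp
  moreover have "\<eta> d \<otimes>\<^bsub>G\<^esub> inv\<^bsub>G\<^esub> (\<eta> c) \<in> E"
    using \<eta>_in_E[OF c] \<eta>_in_E[OF d] by simp
  ultimately have 1: "\<eta> d \<otimes>\<^bsub>G\<^esub> inv\<^bsub>G\<^esub> (\<eta> c) = \<one>\<^bsub>G\<^esub>" "inv\<^bsub>G\<^esub> j \<otimes>\<^bsub>G\<^esub> (i \<otimes>\<^bsub>G\<^esub> c) = \<one>\<^bsub>G\<^esub>"
    using eq K_Int_E_D by metis+
  \<comment> \<open>Injectivity of \<eta> is not assumed, so \<open>d\<close> and \<open>c\<close>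
    may differ; equal images suffice to replace \<open>d\<close> by \<open>c\<close>.\<close>
  have dc: "\<eta> d = \<eta> c" using 1(1) by (metis G.inv_equality G.inv_inv G.inv_closed \<open>\<eta> c \<in> carrier G\<close> \<open>\<eta> d \<in> carrier G\<close>)
  have "c = inv\<^bsub>G\<^esub> i \<otimes>\<^bsub>G\<^esub> (j \<otimes>\<^bsub>G\<^esub> (inv\<^bsub>G\<^esub> j \<otimes>\<^bsub>G\<^esub> (i \<otimes>\<^bsub>G\<^esub> c)))"
    by (simp add: G.m_assoc[symmetric])
  then have "c = inv\<^bsub>G\<^esub> i \<otimes>\<^bsub>G\<^esub> j" using 1(2) by simp
  then have "c \<in> I" using i j by simp
  then show "\<exists>i\<in>I. \<exists>c\<in>I. x = i \<otimes>\<^bsub>G\<^esub> \<eta> c" using j xj dc by auto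
next
  assume "\<exists>i\<in>I. \<exists>c\<in>I. x = i \<otimes>\<^bsub>G\<^esub> \<eta> c"
  then obtain i c where i: "i \<in> I" and c: "c \<in> I" and x: "x = i \<otimes>\<^bsub>G\<^esub> \<eta> c" by blast
  have cK: "c \<in> K" by (rule I_in_K[OF c])
  \<comment> \<open>The factor c \<eta>(c) is the element of \<open>H\<close> belonging to
    \<open>c\<close>; compensating by c^-1 stays in I because c lies in I.\<close>
  have "x = (i \<otimes>\<^bsub>G\<^esub> inv\<^bsub>G\<^esub> c) \<otimes>\<^bsub>G\<^esub> (c \<otimes>\<^bsub>G\<^esub> \<eta> c)"
    using I.mem_carrier[OF i] I.mem_carrier[OF c] \<eta>_in_G[OF cK]
    by (simp add: x G.m_assoc G.inv_mult_cancel G.mult_inv_cancel)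
  moreover have "i \<otimes>\<^bsub>G\<^esub> inv\<^bsub>G\<^esub> c \<in> I" using i c by simp
  ultimately have "x \<in> I <#>\<^bsub>G\<^esub> H" using cK using H_eq unfolding set_mult_def by blast
  moreover have "x \<in> I <#>\<^bsub>G\<^esub> E" using i x \<eta>_in_E[OF cK] unfolding set_mult_def by blast
  ultimately show "x \<in> T" by (simp add: T_def)
qed

lemma T_memI: "\<lbrakk>i \<in> I; c \<in> I\<rbrakk> \<Longrightarrow> i \<otimes>\<^bsub>G\<^esub> \<eta> c \<in> T"
  using T_iff by blast

lemma subgroup_T: "subgroup T G"
  unfolding T_def
  by (intro G.subgroups_Inter_pair G.mult_norm_subgroup normal_I subgroup_H subgroup_E)

text \<open>Since \<open>I\<close> is normal in the multiplicative group, \<open>c \<cdot> u = u \<cdot> c'\<close> with \<open>c' \<in> I\<close>, so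
  \<open>\<lambda>\<^sub>c\<close> induces the identity on \<open>K / I\<close> for \<open>c \<in> I\<close>.\<close>

lemma lambda_trivial_mod_ideal:
  assumes k: "k \<in> K" and c: "c \<in> I"
  shows "k \<otimes>\<^bsub>G\<^esub> brace_lambda B c (inv\<^bsub>G\<^esub> k) \<in> I"
proof -
  define u where "u = inv\<^bsub>G\<^esub> k"
  define c' where "c' = inv\<^bsub>B\<^esub> u \<otimes>\<^bsub>B\<^esub> c \<otimes>\<^bsub>B\<^esub> u"
  have u: "u \<in> K" using k by (simp add: u_def)
  have cK: "c \<in> K" by (rule I_in_K[OF c])
  have c': "c' \<in> I" using IB.inv_op_closed1[of u c] u c by (simp add: c'_def K_eq)
  have "c \<otimes>\<^bsub>B\<^esub> u = u \<otimes>\<^bsub>B\<^esub> c'"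
    using u cK by (simp add: c'_def K_eq B.m_assoc[symmetric])
  also have "\<dots> = u \<otimes>\<^bsub>G\<^esub> brace_lambda B u c'"
    using u I_in_K[OF c'] K.mem_carrier B_mult_closed[OF u I_in_K[OF c']]
    by (simp add: lambda_eq G.m_assoc[symmetric])
  finally have e: "c \<otimes>\<^bsub>B\<^esub> u = u \<otimes>\<^bsub>G\<^esub> brace_lambda B u c'" .
  have l: "brace_lambda B u c' \<in> I" by (rule lambda_ideal[OF u c'])
  \<comment> \<open>Substitute c \<cdot> u = u \<lambda>_u(c') into \<lambda>_c(u) = c^-1 (c \<cdot>
    u), where u = k^-1. A conjugate of c^-1 and \<lambda>_u(c') remain, both in I.\<close>
  have "k \<otimes>\<^bsub>G\<^esub> brace_lambda B c u = (k \<otimes>\<^bsub>G\<^esub> inv\<^bsub>G\<^esub> c \<otimes>\<^bsub>G\<^esub> inv\<^bsub>G\<^esub> k) \<otimes>\<^bsub>G\<^esub> brace_lambda B u c'"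
    using k cK l K.mem_carrier I.mem_carrier u
    by (simp only: lambda_eq[OF cK u] e) (simp add: u_def G.m_assoc)
  moreover have "k \<otimes>\<^bsub>G\<^esub> inv\<^bsub>G\<^esub> c \<otimes>\<^bsub>G\<^esub> inv\<^bsub>G\<^esub> k \<in> I"
    using I.inv_op_closed2[of k "inv\<^bsub>G\<^esub> c"] k c K.mem_carrier by simp
  ultimately show ?thesis using l by (simp add: u_def)
qed

text \<open>Conjugating i \<eta>(c) by k keeps \<eta>(c) and contributes the factor k
  \<lambda>_c(k^-1), which is in I by \<open>lambda_trivial_mod_ideal\<close>. Conjugating by
  \<eta>(d) conjugates i inside I and replaces c by its conjugate under d in the multiplicative
  group.\<close>

lemma normal_T: "T \<lhd> G"
proof (rule normal_via_KE[OF subgroup_T])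
  fix k x assume k: "k \<in> K" and x: "x \<in> T"
  obtain i c where i: "i \<in> I" and c: "c \<in> I" and xe: "x = i \<otimes>\<^bsub>G\<^esub> \<eta> c" using x T_iff by blast
  have cK: "c \<in> K" by (rule I_in_K[OF c])
  note [simp] = K.mem_carrier[OF k] I.mem_carrier[OF i] \<eta>_in_G[OF cK]
  let ?l = "brace_lambda B c (inv\<^bsub>G\<^esub> k)"
  have l: "?l = \<eta> c \<otimes>\<^bsub>G\<^esub> inv\<^bsub>G\<^esub> k \<otimes>\<^bsub>G\<^esub> inv\<^bsub>G\<^esub> (\<eta> c)"
    using \<eta>_conj[OF cK, of "inv\<^bsub>G\<^esub> k"] k by simp
  have "k \<otimes>\<^bsub>G\<^esub> x \<otimes>\<^bsub>G\<^esub> inv\<^bsub>G\<^esub> k = (k \<otimes>\<^bsub>G\<^esub> i \<otimes>\<^bsub>G\<^esub> inv\<^bsub>G\<^esub> k) \<otimes>\<^bsub>G\<^esub> (k \<otimes>\<^bsub>G\<^esub> ?l) \<otimes>\<^bsub>G\<^esub> \<eta> c"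
    by (simp add: xe l G.m_assoc G.inv_mult_cancel G.mult_inv_cancel)
  moreover have "(k \<otimes>\<^bsub>G\<^esub> i \<otimes>\<^bsub>G\<^esub> inv\<^bsub>G\<^esub> k) \<otimes>\<^bsub>G\<^esub> (k \<otimes>\<^bsub>G\<^esub> ?l) \<in> I"
    using I.inv_op_closed2[of k i] lambda_trivial_mod_ideal[OF k c] i by simp
  ultimately show "k \<otimes>\<^bsub>G\<^esub> x \<otimes>\<^bsub>G\<^esub> inv\<^bsub>G\<^esub> k \<in> T" using T_memI[OF _ c] by simp
next
  fix d x assume d: "d \<in> K" and x: "x \<in> T"
  obtain i c where i: "i \<in> I" and c: "c \<in> I" and xe: "x = i \<otimes>\<^bsub>G\<^esub> \<eta> c" using x T_iff by blast
  have cK: "c \<in> K" by (rule I_in_K[OF c])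
  note [simp] = \<eta>_in_G[OF d] I.mem_carrier[OF i] \<eta>_in_G[OF cK]
  have dc: "d \<otimes>\<^bsub>B\<^esub> c \<otimes>\<^bsub>B\<^esub> inv\<^bsub>B\<^esub> d \<in> I"
    using IB.inv_op_closed2[of d c] d c by (simp add: K_eq)
  have "inv\<^bsub>B\<^esub> d \<in> K" using d by (simp add: K_eq)
  then have "\<eta> (d \<otimes>\<^bsub>B\<^esub> c \<otimes>\<^bsub>B\<^esub> inv\<^bsub>B\<^esub> d) = \<eta> d \<otimes>\<^bsub>G\<^esub> \<eta> c \<otimes>\<^bsub>G\<^esub> inv\<^bsub>G\<^esub> (\<eta> d)"
    using d cK by (simp add: \<eta>_mult B_mult_closed \<eta>_inv)
  then have "\<eta> d \<otimes>\<^bsub>G\<^esub> x \<otimes>\<^bsub>G\<^esub> inv\<^bsub>G\<^esub> (\<eta> d) =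
      (\<eta> d \<otimes>\<^bsub>G\<^esub> i \<otimes>\<^bsub>G\<^esub> inv\<^bsub>G\<^esub> (\<eta> d)) \<otimes>\<^bsub>G\<^esub> \<eta> (d \<otimes>\<^bsub>B\<^esub> c \<otimes>\<^bsub>B\<^esub> inv\<^bsub>B\<^esub> d)"
    by (simp add: xe G.m_assoc G.inv_mult_cancel G.mult_inv_cancel)
  then show "\<eta> d \<otimes>\<^bsub>G\<^esub> x \<otimes>\<^bsub>G\<^esub> inv\<^bsub>G\<^esub> (\<eta> d) \<in> T"
    using T_memI[OF _ dc] I.inv_op_closed2[of "\<eta> d" i] i by simp
qed

interpretation T: normal T G by (rule normal_T)

lemma T_Int_K: "T \<inter> K = I"
proof (intro equalityI subsetI)
  fix x assume x: "x \<in> T \<inter> K"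
  then obtain i c where i: "i \<in> I" and c: "c \<in> I" and xe: "x = i \<otimes>\<^bsub>G\<^esub> \<eta> c" using T_iff by blast
  have cK: "c \<in> K" by (rule I_in_K[OF c])
  have "\<eta> c = inv\<^bsub>G\<^esub> i \<otimes>\<^bsub>G\<^esub> x"
    using I.mem_carrier[OF i] \<eta>_in_G[OF cK] by (simp add: xe G.m_assoc[symmetric])
  then have "\<eta> c \<in> K" using x I_in_K[OF i] by simp
  then have "\<eta> c = \<one>\<^bsub>G\<^esub>" using K_Int_E_D \<eta>_in_E[OF cK] by blast
  then show "x \<in> I" using i xe I.mem_carrier[OF i] by simp
next
  fix x assume x: "x \<in> I"
  then have "x = x \<otimes>\<^bsub>G\<^esub> \<eta> \<one>\<^bsub>B\<^esub>" using I.mem_carrier by (simp add: \<eta>_one)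
  then have "x \<in> T" using T_memI[OF x IB.one_closed] by simp
  then show "x \<in> T \<inter> K" using I_in_K[OF x] by simp
qed

abbreviation L :: "'g set" where "L \<equiv> K <#>\<^bsub>G\<^esub> T"

lemma subgroup_L: "subgroup L G"
  by (rule G.mult_norm_subgroup[OF normal_K subgroup_T])

lemma L_memI: "\<lbrakk>k \<in> K; t \<in> T\<rbrakk> \<Longrightarrow> k \<otimes>\<^bsub>G\<^esub> t \<in> L"
  unfolding set_mult_def by blast

lemma L_memE:
  assumes "x \<in> L"
  obtains k t where "k \<in> K" "t \<in> T" "x = k \<otimes>\<^bsub>G\<^esub> t"
  using assms unfolding set_mult_def by blast

lemma T_subset_L: "T \<subseteq> L"
  using L_memI[of "\<one>\<^bsub>G\<^esub>"] T.mem_carrier by fastforce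

lemma K_subset_L: "K \<subseteq> L"
  using L_memI[of _ "\<one>\<^bsub>G\<^esub>"] K.mem_carrier by fastforce

text \<open>If x = k i \<eta>(c), then x \<eta>(c)^-1 = k i lies in both \<open>E\<close> and
  \<open>K\<close>, so x = \<eta>(c). Hence distinct cosets of T in ET stay distinct modulo
  L.\<close>

lemma E_Int_L:
  assumes "x \<in> E" "x \<in> L"
  shows "x \<in> T"
proof -
  obtain k t where k: "k \<in> K" and t: "t \<in> T" and xk: "x = k \<otimes>\<^bsub>G\<^esub> t" using L_memE[OF assms(2)] .
  obtain i c where i: "i \<in> I" and c: "c \<in> I" and tc: "t = i \<otimes>\<^bsub>G\<^esub> \<eta> c" using t T_iff by blast
  have cK: "c \<in> K" by (rule I_in_K[OF c])
  have e: "x \<otimes>\<^bsub>G\<^esub> inv\<^bsub>G\<^esub> (\<eta> c) = k \<otimes>\<^bsub>G\<^esub> i"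
    using K.mem_carrier[OF k] I.mem_carrier[OF i] \<eta>_in_G[OF cK] by (simp add: xk tc G.m_assoc)
  have "k \<otimes>\<^bsub>G\<^esub> i \<in> K" using k I_in_K[OF i] by simp
  moreover have "x \<otimes>\<^bsub>G\<^esub> inv\<^bsub>G\<^esub> (\<eta> c) \<in> E" using assms(1) \<eta>_in_E[OF cK] by simp
  ultimately have "k \<otimes>\<^bsub>G\<^esub> i = \<one>\<^bsub>G\<^esub>" using e K_Int_E_D by simp
  then have "x = \<eta> c"
    using K.mem_carrier[OF k] I.mem_carrier[OF i] \<eta>_in_G[OF cK] by (simp add: xk tc G.m_assoc[symmetric])
  then show ?thesis using T_memI[OF I.one_closed c] \<eta>_in_G[OF cK] by simp
qed

section \<open>Cosets of T in ET as a transversal of KT\<close>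

abbreviation cosets :: "'g set set" where
  "cosets \<equiv> carrier ((G\<lparr>carrier := E <#>\<^bsub>G\<^esub> T\<rparr>) Mod T)"

text \<open>This is the choice made in \<open>coset_translate\<close>, repeated literally so that
  both select the same representatives.\<close>

definition coset_rep :: "'g set \<Rightarrow> 'g" where
  "coset_rep C = (SOME e. e \<in> E \<and> C = T #>\<^bsub>G\<^esub> e)"

text \<open>The quotient consists of right cosets, whereas the transversal condition speaks of a^-1
  b; normality of T lets the second decide the first.\<close>

lemma coset_eq_iff:
  assumes "a \<in> carrier G" "b \<in> carrier G"
  shows "T #>\<^bsub>G\<^esub> a = T #>\<^bsub>G\<^esub> b \<longleftrightarrow> inv\<^bsub>G\<^esub> a \<otimes>\<^bsub>G\<^esub> b \<in> T"
proof
  assume "T #>\<^bsub>G\<^esub> a = T #>\<^bsub>G\<^esub> b"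
  then have "b \<in> T #>\<^bsub>G\<^esub> a" using G.rcos_self[OF assms(2) subgroup_T] by simp
  then obtain t where t: "t \<in> T" "b = t \<otimes>\<^bsub>G\<^esub> a" by (auto simp: r_coset_def)
  then show "inv\<^bsub>G\<^esub> a \<otimes>\<^bsub>G\<^esub> b \<in> T"
    using T.inv_op_closed1[OF assms(1) t(1)] assms T.mem_carrier[OF t(1)] by (simp add: G.m_assoc)
next
  assume t: "inv\<^bsub>G\<^esub> a \<otimes>\<^bsub>G\<^esub> b \<in> T"
  have "b = (a \<otimes>\<^bsub>G\<^esub> (inv\<^bsub>G\<^esub> a \<otimes>\<^bsub>G\<^esub> b) \<otimes>\<^bsub>G\<^esub> inv\<^bsub>G\<^esub> a) \<otimes>\<^bsub>G\<^esub> a"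
    using assms by (simp add: G.m_assoc G.inv_mult_cancel G.mult_inv_cancel)
  then have "b \<in> T #>\<^bsub>G\<^esub> a" using T.inv_op_closed2[OF assms(1) t] unfolding r_coset_def by blast
  then show "T #>\<^bsub>G\<^esub> a = T #>\<^bsub>G\<^esub> b" using G.repr_independence[OF _ assms(1) subgroup_T] by blast
qed

lemma cosets_eq: "cosets = (\<lambda>e. T #>\<^bsub>G\<^esub> e) ` E"
proof (intro equalityI subsetI)
  fix C assume "C \<in> cosets"
  then obtain e t where e: "e \<in> E" and t: "t \<in> T" and C: "C = T #>\<^bsub>G\<^esub> (e \<otimes>\<^bsub>G\<^esub> t)"
    by (auto simp: carrier_FactGroup set_mult_def)
  have "T #>\<^bsub>G\<^esub> e = T #>\<^bsub>G\<^esub> (e \<otimes>\<^bsub>G\<^esub> t)"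
    using e t T.mem_carrier[OF t] by (subst coset_eq_iff) (simp_all add: G.m_assoc[symmetric])
  then show "C \<in> (\<lambda>e. T #>\<^bsub>G\<^esub> e) ` E" using e C by blast
next
  fix C assume "C \<in> (\<lambda>e. T #>\<^bsub>G\<^esub> e) ` E"
  then obtain e where e: "e \<in> E" "C = T #>\<^bsub>G\<^esub> e" by blast
  have "e = e \<otimes>\<^bsub>G\<^esub> \<one>\<^bsub>G\<^esub>" using e by simp
  then have "e \<in> E <#>\<^bsub>G\<^esub> T" using e T.one_closed unfolding set_mult_def by blast
  then show "C \<in> cosets" using e by (auto simp: carrier_FactGroup)
qed

lemma coset_rep:
  assumes "C \<in> cosets"
  shows coset_rep_in_E: "coset_rep C \<in> E" and coset_rep_coset: "C = T #>\<^bsub>G\<^esub> coset_rep C"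
proof -
  have "\<exists>e. e \<in> E \<and> C = T #>\<^bsub>G\<^esub> e" using assms unfolding cosets_eq by blast
  from someI_ex[OF this] show "coset_rep C \<in> E" "C = T #>\<^bsub>G\<^esub> coset_rep C"
    unfolding coset_rep_def by blast+
qed

lemma coset_rep_in_G: "C \<in> cosets \<Longrightarrow> coset_rep C \<in> carrier G"
  by (rule E.mem_carrier[OF coset_rep_in_E])

text \<open>Write g = k e and let f represent the coset of e: then f^-1 g = (f^-1 k f)(f^-1 e) lies
  in KT. If d serves as well, d^-1 f lies in \<open>E\<close> and in L, hence in T by
  \<open>E_Int_L\<close>.\<close>

lemma coset_rep_transversal:
  assumes g: "g \<in> carrier G"
  shows "\<exists>!C. C \<in> cosets \<and> inv\<^bsub>G\<^esub> (coset_rep C) \<otimes>\<^bsub>G\<^esub> g \<in> L"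
proof -
  obtain k e where k: "k \<in> K" and e: "e \<in> E" and ge: "g = k \<otimes>\<^bsub>G\<^esub> e" using KE_decomp[OF g] .
  let ?C = "T #>\<^bsub>G\<^esub> e"
  have C: "?C \<in> cosets" using e unfolding cosets_eq by blast
  define f where "f = coset_rep ?C"
  have f: "f \<in> carrier G" using coset_rep_in_E[OF C] by (simp add: f_def)
  have "inv\<^bsub>G\<^esub> f \<otimes>\<^bsub>G\<^esub> e \<in> T"
    using coset_rep_coset[OF C] f e coset_eq_iff[of f e] by (simp add: f_def)
  moreover have "inv\<^bsub>G\<^esub> f \<otimes>\<^bsub>G\<^esub> k \<otimes>\<^bsub>G\<^esub> f \<in> K" by (rule K.inv_op_closed1[OF f k])
  moreover have "inv\<^bsub>G\<^esub> f \<otimes>\<^bsub>G\<^esub> g = (inv\<^bsub>G\<^esub> f \<otimes>\<^bsub>G\<^esub> k \<otimes>\<^bsub>G\<^esub> f) \<otimes>\<^bsub>G\<^esub> (inv\<^bsub>G\<^esub> f \<otimes>\<^bsub>G\<^esub> e)"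
    using f e K.mem_carrier[OF k] by (simp add: ge G.m_assoc G.inv_mult_cancel G.mult_inv_cancel)
  ultimately have ex: "inv\<^bsub>G\<^esub> (coset_rep ?C) \<otimes>\<^bsub>G\<^esub> g \<in> L" using L_memI by (simp add: f_def)
  show ?thesis
  proof (rule ex1I[of _ ?C])
    show "?C \<in> cosets \<and> inv\<^bsub>G\<^esub> (coset_rep ?C) \<otimes>\<^bsub>G\<^esub> g \<in> L" using C ex by blast
    fix D assume D: "D \<in> cosets \<and> inv\<^bsub>G\<^esub> (coset_rep D) \<otimes>\<^bsub>G\<^esub> g \<in> L"
    define d where "d = coset_rep D"
    have d: "d \<in> E" using coset_rep_in_E D by (simp add: d_def)
    have fE: "f \<in> E" using coset_rep_in_E[OF C] by (simp add: f_def)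
    have "(inv\<^bsub>G\<^esub> d \<otimes>\<^bsub>G\<^esub> g) \<otimes>\<^bsub>G\<^esub> inv\<^bsub>G\<^esub> (inv\<^bsub>G\<^esub> f \<otimes>\<^bsub>G\<^esub> g) \<in> L"
      using D ex subgroup.m_closed[OF subgroup_L] subgroup.m_inv_closed[OF subgroup_L]
      by (simp add: d_def f_def)
    moreover have "(inv\<^bsub>G\<^esub> d \<otimes>\<^bsub>G\<^esub> g) \<otimes>\<^bsub>G\<^esub> inv\<^bsub>G\<^esub> (inv\<^bsub>G\<^esub> f \<otimes>\<^bsub>G\<^esub> g) = inv\<^bsub>G\<^esub> d \<otimes>\<^bsub>G\<^esub> f"
      using d f g by (simp add: G.inv_mult_group G.m_assoc G.inv_mult_cancel G.mult_inv_cancel)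
    ultimately have "inv\<^bsub>G\<^esub> d \<otimes>\<^bsub>G\<^esub> f \<in> T" using E_Int_L d fE by simp
    then have "T #>\<^bsub>G\<^esub> d = T #>\<^bsub>G\<^esub> f" using coset_eq_iff d f by simp
    then show "D = ?C" using coset_rep_coset D C by (metis d_def f_def)
  qed
qed

lemma finite_cosets: "finite cosets"
  unfolding cosets_eq using finite_subset[OF E.subset finite_G] by simp

text \<open>Once T \<inter> K = I is known, (IR1) for T is its definition.\<close>

lemma kernel_T: "trifactorised_kernel G K H E T"
  unfolding trifactorised_kernel_def T_Int_K by (simp add: T_def)

text \<open>Supplies the hypothesis \<open>triv\<close> of \<open>kernel_irep\<close>: on the zero
  space every \<rho>(k) is the identity, so I = K.\<close>

lemma L_eq_G:
  assumes "I = K"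
  shows "L = carrier G"
proof -
  have "T = (K <#>\<^bsub>G\<^esub> H) \<inter> (K <#>\<^bsub>G\<^esub> E)" using T_def assms by simp
  then have "T = carrier G" using G_eq_KH G_eq_KE by simp
  then show ?thesis using T_subset_L subgroup.subset[OF subgroup_L] by blast
qed

end

section \<open>The representation induced from a brace representation\<close>

theorem proposition4p4:
  fixes B :: "'g ring" and F :: "'f ring" and V :: "('f, 'v) module"
    and \<rho> :: "'g \<Rightarrow> 'v \<Rightarrow> 'v"
    and G :: "'g monoid" and K H E T :: "'g set"
    and \<sigma> :: "'g \<Rightarrow> 'v \<Rightarrow> 'v"
    and W :: "('f, ('g, 'f, 'v) ind_space) module"
    and \<rho>' :: "'g \<Rightarrow> ('g, 'f, 'v) ind_space \<Rightarrow> ('g, 'f, 'v) ind_space"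
  assumes "skew_left_brace B" and "finite (carrier B)"
    and "field F"
    and "brace_rep F B V \<rho>"
    and "associated_trifactorised_group B G K H E"
    and "T = (kernel (add_monoid B) (GL F V) \<rho> <#>\<^bsub>G\<^esub> H) \<inter> (kernel (add_monoid B) (GL F V) \<rho> <#>\<^bsub>G\<^esub> E)"
    and "\<sigma> = extended_action G K T \<rho>"
    and "W = ind_module F G (K <#>\<^bsub>G\<^esub> T) V \<sigma>"
    and "\<rho>' = ind_rep F G (K <#>\<^bsub>G\<^esub> T) V \<sigma>"
  shows "T \<lhd> G \<and> T \<inter> K = kernel (add_monoid B) (GL F V) \<rho>
    \<and> group_rep F (G\<lparr>carrier := K <#>\<^bsub>G\<^esub> T\<rparr>) V \<sigma>
    \<and> (\<forall>k\<in>K. \<forall>t\<in>T. \<forall>v\<in>carrier V. \<sigma> (k \<otimes>\<^bsub>G\<^esub> t) v = \<rho> k v)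
    \<and> (\<forall>g\<in>carrier G. \<forall>\<omega>\<in>carrier (group_algebra F G). \<forall>v\<in>carrier V.
         \<rho>' g (ind_tensor F G (K <#>\<^bsub>G\<^esub> T) V \<sigma> \<omega> v) =
         ind_tensor F G (K <#>\<^bsub>G\<^esub> T) V \<sigma> (group_algebra_basis F G g \<otimes>\<^bsub>group_algebra F G\<^esub> \<omega>) v)
    \<and> trifactorised_rep F G K H E W \<rho>'
    \<and> induced_trifactorised_rep F G K H E V \<rho> W \<rho>'"
proof -
  define I where "I = kernel (add_monoid B) (GL F V) \<rho>"
  obtain \<eta> where "associated_epi B G K H E \<eta>" and "trifactorised_group G K H E"
    using assms(5) by (auto simp: associated_trifactorised_group_def)
  then interpret P: brace_trifactorisation B G K H E I \<eta>
    using assms(1,4) by unfold_locales (simp_all add: brace_rep_def I_def)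
  have T: "T = P.T" unfolding assms(6) I_def[symmetric] by (rule P.T_def[symmetric])
  interpret G: group G by (rule P.group_G)
  interpret K: normal K G by (rule P.normal_K)
  interpret TN: normal T G unfolding T by (rule P.normal_T)
  have addB: "group (add_monoid B)" using assms(1) by (simp add: skew_left_brace_def)
  have rep: "group_rep F (add_monoid B) V \<rho>" using assms(4) by (simp add: brace_rep_def)
  then have V: "module F V" and \<rho>: "\<rho> \<in> hom (add_monoid B) (GL F V)" by (auto simp: group_rep_def)
  interpret F: field F by (rule assms(3))
  interpret V: module F V by (rule V)
  interpret GL: group "GL F V" by (rule group_GL[OF V])
  have \<rho>_in: "\<rho> k \<in> carrier (GL F V)" if "k \<in> K" for k
    using hom_in_carrier[OF \<rho>, of k] that P.K_eq by simp
  have \<rho>_mult: "\<rho> (k \<otimes>\<^bsub>G\<^esub> j) = \<rho> k \<otimes>\<^bsub>GL F V\<^esub> \<rho> j" if "k \<in> K" "j \<in> K" for k j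
    using hom_mult[OF \<rho>, of k j] that P.K_eq P.B_add[OF that] by simp
  have \<rho>_ker: "k \<in> I \<longleftrightarrow> k \<in> K \<and> \<rho> k = \<one>\<^bsub>GL F V\<^esub>" for k
    by (auto simp: I_def kernel_def P.K_eq)
  have \<sigma>_eq: "\<sigma> (k \<otimes>\<^bsub>G\<^esub> t) = \<rho> k" if k: "k \<in> K" and t: "t \<in> T" for k t
  proof -
    \<comment> \<open>\<open>j\<close> is the factor that \<open>extended_action\<close> selects for
      k t. It differs from \<open>k\<close> by an element of K \<inter> T = I, on which \<rho> is
      trivial.\<close>
    define j where "j = (SOME j. j \<in> K \<and> (\<exists>s\<in>T. k \<otimes>\<^bsub>G\<^esub> t = j \<otimes>\<^bsub>G\<^esub> s))"
    have "\<exists>j. j \<in> K \<and> (\<exists>s\<in>T. k \<otimes>\<^bsub>G\<^esub> t = j \<otimes>\<^bsub>G\<^esub> s)" using k t by blast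
    from someI_ex[OF this] obtain s where j: "j \<in> K" and s: "s \<in> T" and e: "k \<otimes>\<^bsub>G\<^esub> t = j \<otimes>\<^bsub>G\<^esub> s"
      unfolding j_def by blast
    note [simp] = K.mem_carrier[OF k] K.mem_carrier[OF j] TN.mem_carrier[OF t] TN.mem_carrier[OF s]
    have "inv\<^bsub>G\<^esub> j \<otimes>\<^bsub>G\<^esub> k = inv\<^bsub>G\<^esub> j \<otimes>\<^bsub>G\<^esub> (k \<otimes>\<^bsub>G\<^esub> t) \<otimes>\<^bsub>G\<^esub> inv\<^bsub>G\<^esub> t"
      by (simp add: G.m_assoc)
    also have "\<dots> = s \<otimes>\<^bsub>G\<^esub> inv\<^bsub>G\<^esub> t" by (simp add: e G.m_assoc G.inv_mult_cancel)
    finally have "inv\<^bsub>G\<^esub> j \<otimes>\<^bsub>G\<^esub> k \<in> T" using s t by simp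
    moreover have jk: "inv\<^bsub>G\<^esub> j \<otimes>\<^bsub>G\<^esub> k \<in> K" using j k by simp
    ultimately have "\<rho> (inv\<^bsub>G\<^esub> j \<otimes>\<^bsub>G\<^esub> k) = \<one>\<^bsub>GL F V\<^esub>" using P.T_Int_K T \<rho>_ker by blast
    then have "\<rho> k = \<rho> j"
      using \<rho>_mult[OF j jk] \<rho>_in[OF j] by (simp add: G.mult_inv_cancel)
    then show ?thesis by (simp add: assms(7) extended_action_def j_def)
  qed
  have \<sigma>_rep: "group_rep F (G\<lparr>carrier := P.L\<rparr>) V \<sigma>"
  proof -
    have "\<sigma> \<in> hom (G\<lparr>carrier := P.L\<rparr>) (GL F V)"
    proof (rule homI)
      show "\<sigma> x \<in> carrier (GL F V)" if "x \<in> carrier (G\<lparr>carrier := P.L\<rparr>)" for x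
        using that \<sigma>_eq \<rho>_in T by (auto elim!: P.L_memE)
      fix x y assume "x \<in> carrier (G\<lparr>carrier := P.L\<rparr>)" and "y \<in> carrier (G\<lparr>carrier := P.L\<rparr>)"
      then obtain k t j s where k: "k \<in> K" and t: "t \<in> T" and x: "x = k \<otimes>\<^bsub>G\<^esub> t"
        and j: "j \<in> K" and s: "s \<in> T" and y: "y = j \<otimes>\<^bsub>G\<^esub> s"
        using T by (auto elim!: P.L_memE)
      note [simp] = K.mem_carrier[OF k] K.mem_carrier[OF j] TN.mem_carrier[OF t] TN.mem_carrier[OF s]
      \<comment> \<open>The factors from \<open>K\<close> are collected on the left, at the cost of
        conjugating t, so that \<open>\<sigma>_eq\<close> reads off \<rho>(k j).\<close>
      have "x \<otimes>\<^bsub>G\<^esub> y = (k \<otimes>\<^bsub>G\<^esub> j) \<otimes>\<^bsub>G\<^esub> ((inv\<^bsub>G\<^esub> j \<otimes>\<^bsub>G\<^esub> t \<otimes>\<^bsub>G\<^esub> j) \<otimes>\<^bsub>G\<^esub> s)"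
        by (simp add: x y G.m_assoc G.mult_inv_cancel)
      moreover have "(inv\<^bsub>G\<^esub> j \<otimes>\<^bsub>G\<^esub> t \<otimes>\<^bsub>G\<^esub> j) \<otimes>\<^bsub>G\<^esub> s \<in> T"
        using TN.inv_op_closed1[of j t] s t by simp
      ultimately have "\<sigma> (x \<otimes>\<^bsub>G\<^esub> y) = \<rho> (k \<otimes>\<^bsub>G\<^esub> j)"
        using \<sigma>_eq[of "k \<otimes>\<^bsub>G\<^esub> j"] k j by simp
      then show "\<sigma> (x \<otimes>\<^bsub>G\<lparr>carrier := P.L\<rparr>\<^esub> y) = \<sigma> x \<otimes>\<^bsub>GL F V\<^esub> \<sigma> y"
        by (simp add: \<rho>_mult k j x y \<sigma>_eq t s)
    qed
    then show ?thesis using V assms(3) by (simp add: group_rep_def)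
  qed
  interpret L: subgroup P.L G by (rule P.subgroup_L)
  \<comment> \<open>The abstract index set becomes the set of cosets of T in ET, matching the index
    set of (IR2)(b) once the kernel is known.\<close>
  interpret R: induced_transversal F G P.L V \<sigma> P.cosets P.coset_rep
    by unfold_locales (rule P.finite_G \<sigma>_rep P.finite_cosets |
      erule P.coset_rep_in_G P.coset_rep_transversal)+
  have W: "W = R.W" and \<rho>': "\<rho>' = R.irep" by (simp_all add: assms(8,9) T)
  have \<sigma>_K: "\<sigma> k = \<rho> k" if "k \<in> K" for k
    using \<sigma>_eq[OF that TN.one_closed] K.mem_carrier[OF that] by simp
  have ker: "kernel G (GL F W) \<rho>' = T"
    unfolding W \<rho>'
  proof (rule R.kernel_irep)
    show "T \<lhd> G" by (rule TN.normal_axioms)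
    show "T \<subseteq> P.L" unfolding T by (rule P.T_subset_L)
  next
    fix t v assume t: "t \<in> T" and v: "v \<in> carrier V"
    have "\<sigma> t = \<rho> \<one>\<^bsub>G\<^esub>" using \<sigma>_eq[OF K.one_closed t] TN.mem_carrier[OF t] by simp
    then show "\<sigma> t v = v" using R.\<sigma>_one[OF v] \<sigma>_K[OF K.one_closed] by simp
  next
    fix l assume l: "l \<in> P.L" and triv: "\<And>v. v \<in> carrier V \<Longrightarrow> \<sigma> l v = v"
    obtain k t where k: "k \<in> K" and t: "t \<in> T" and lk: "l = k \<otimes>\<^bsub>G\<^esub> t" using l T by (auto elim!: P.L_memE)
    \<comment> \<open>\<rho>(k) acts as the identity on V; extensionality makes it the unit of
      \<open>GL F V\<close>, so k lies in the kernel I of \<rho>.\<close>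
    have "\<rho> k \<in> extensional (carrier V)" using \<rho>_in[OF k] by (simp add: carrier_GL Bij_def)
    then have "\<rho> k = \<one>\<^bsub>GL F V\<^esub>"
      using triv \<sigma>_eq[OF k t] unfolding one_GL lk by (intro extensionalityI[of _ "carrier V"]) auto
    then have "k \<in> T" using \<rho>_ker k P.T_Int_K T by blast
    then show "l \<in> T" using t lk by simp
  next
    assume z: "carrier V = {\<zero>\<^bsub>V\<^esub>}"
    have "\<rho> k = \<one>\<^bsub>GL F V\<^esub>" if k: "k \<in> K" for k
    proof (rule extensionalityI[of _ "carrier V"])
      show "\<rho> k \<in> extensional (carrier V)" using \<rho>_in[OF k] by (simp add: carrier_GL Bij_def)
      show "\<one>\<^bsub>GL F V\<^esub> \<in> extensional (carrier V)" by (simp add: one_GL)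
      fix v assume v: "v \<in> carrier V"
      then have "\<rho> k v \<in> carrier V"
        using linear_maps_closed[of "\<rho> k" F V V] \<rho>_in[OF k] by (simp add: carrier_GL)
      then show "\<rho> k v = \<one>\<^bsub>GL F V\<^esub> v" using v by (simp add: one_GL z)
    qed
    then have "I = K" using \<rho>_ker by blast
    then show "P.L = carrier G" by (rule P.L_eq_G)
  qed
  have irep_K: "R.irep k (R.tens (R.basis \<one>\<^bsub>G\<^esub>) v) = R.tens (R.basis \<one>\<^bsub>G\<^esub>) (\<rho> k v)"
    if k: "k \<in> K" and v: "v \<in> carrier V" for k v
    using R.irep_basis[of k "\<one>\<^bsub>G\<^esub>" v] R.tens_basis_mult(1)[of "\<one>\<^bsub>G\<^esub>" k v] k v P.K_subset_L
      K.mem_carrier[OF k] \<sigma>_K[OF k] by auto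
  have \<rho>_closed: "\<rho> k v \<in> carrier V" if "k \<in> K" "v \<in> carrier V" for k v
    using R.\<sigma>_closed[of k v] \<sigma>_K that P.K_subset_L by auto
  have one_L: "\<one>\<^bsub>G\<^esub> \<in> P.L" by (rule subgroup.one_closed[OF P.subgroup_L])
  have kernel_T: "trifactorised_kernel G K H E (kernel G (GL F W) \<rho>')"
    unfolding ker using P.kernel_T by (simp add: T)
  have "induced_trifactorised_rep F G K H E V \<rho> W \<rho>'"
    unfolding induced_trifactorised_rep_def Let_def
  proof (intro conjI exI)
    show "group_rep F G W \<rho>'" unfolding W \<rho>' by (rule R.group_rep_irep)
    show "trifactorised_kernel G K H E (kernel G (GL F W) \<rho>')" by (rule kernel_T)
    \<comment> \<open>The witnesses are V_0 = 1 \<otimes> V and \<alpha>(v) = 1 \<otimes> v.\<close>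
    show "submodule (R.summand \<one>\<^bsub>G\<^esub>) F W" unfolding W by (rule R.submodule_summand) simp
    show "\<forall>k\<in>K. \<rho>' k ` R.summand \<one>\<^bsub>G\<^esub> \<subseteq> R.summand \<one>\<^bsub>G\<^esub>"
      by (auto simp: \<rho>' R.summand_def irep_K \<rho>_closed)
    show "R.tens (R.basis \<one>\<^bsub>G\<^esub>) \<in> linear_maps F V (W\<lparr>carrier := R.summand \<one>\<^bsub>G\<^esub>\<rparr>)"
      using R.tens_basis_mult(2)[OF _ one_L]
      by (auto simp: linear_maps_def W R.summand_def R.tens_add_right R.basis_closed)
    show "bij_betw (R.tens (R.basis \<one>\<^bsub>G\<^esub>)) (carrier V) (R.summand \<one>\<^bsub>G\<^esub>)"
      by (simp add: bij_betw_def R.summand_def R.inj_tens_basis)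
    show "\<forall>k\<in>K. \<forall>v\<in>carrier V. \<rho>' k (R.tens (R.basis \<one>\<^bsub>G\<^esub>) v) = R.tens (R.basis \<one>\<^bsub>G\<^esub>) (\<rho> k v)"
      by (simp add: \<rho>' irep_K)
    \<comment> \<open>With the kernel replaced by T, the representatives chosen in (IR2)(b) are
      those of the transversal, so \<open>direct_sum\<close> applies verbatim.\<close>
    have "coset_translate G E T \<rho>' (R.summand \<one>\<^bsub>G\<^esub>) = (\<lambda>C. R.irep (P.coset_rep C) ` R.summand \<one>\<^bsub>G\<^esub>)"
      by (simp add: fun_eq_iff coset_translate_def P.coset_rep_def \<rho>' T)
    then show "internal_direct_sum F W
        (carrier ((G\<lparr>carrier := E <#>\<^bsub>G\<^esub> kernel G (GL F W) \<rho>'\<rparr>) Mod kernel G (GL F W) \<rho>'))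
        (coset_translate G E (kernel G (GL F W) \<rho>') \<rho>' (R.summand \<one>\<^bsub>G\<^esub>))"
      unfolding ker using R.direct_sum by (simp add: W T)
  qed
  moreover have "trifactorised_rep F G K H E W \<rho>'"
    unfolding trifactorised_rep_def using kernel_T R.group_rep_irep by (simp add: W \<rho>')
  ultimately show ?thesis
    unfolding I_def[symmetric] using P.normal_T P.T_Int_K \<sigma>_rep \<sigma>_eq R.irep_tens by (simp add: T \<rho>')
qed

end
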